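(* Let $Q\in\{0,1\}^{U\times U}$ be the lower triangular all-ones matrix, $Q_{i,j}=1$ if $j\le i$ and $Q_{i,j}=0$ otherwise. Then $$\gamma_{2,1}(Q)=\Omega\!\left(\frac{\log^{1.5}U}{\log\log U}\right).$$
   Context: $\gamma_{2,1}(Q):=\inf_{Q=AB}\|A\|_{2\to\infty}\|B\|_{1\to1}$, where the infimum is over all factorizations $Q=AB$ with real matrices $A\in\mathbb{R}^{U\times m}$, $B\in\mathbb{R}^{m\times U}$ and arbitrary $m$. Here $\|A\|_{2\to\infty}$ is the largest $\ell_2$-norm of a row of $A$, and $\|B\|_{1\to1}$ is the largest $\ell_1$-norm of a column of $B$. The asymptotics are as $U\to\infty$, with an absolute hidden constant. *)

theory Defs
  imports
    "Jordan_Normal_Form.Matrix"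
    "HOL-Analysis.L2_Norm"
    "HOL-Library.Landau_Symbols"
begin

(* The maxima below are over a nonempty set as soon as A has a row (resp. B has a column);
   the inner dimension of a factorization may be 0, in which case all norms are 0. *)

definition norm_2_to_inf :: "real mat \<Rightarrow> real" where
  "norm_2_to_inf A = (MAX i\<in>{..<dim_row A}. L2_set (\<lambda>k. A $$ (i, k)) {..<dim_col A})"

definition norm_1_to_1 :: "real mat \<Rightarrow> real" where
  "norm_1_to_1 B = (MAX j\<in>{..<dim_col B}. \<Sum>k<dim_row B. \<bar>B $$ (k, j)\<bar>)"

(* For Q with at least one row and one column this is the infimum of a nonempty set
   (take A = Q, B = 1) of nonnegative reals. For a 0 x 0 matrix the value is unspecified. *)

definition gamma_2_1 :: "real mat \<Rightarrow> real" where
  "gamma_2_1 Q = Inf {norm_2_to_inf A * norm_1_to_1 B | A B m.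
     A \<in> carrier_mat (dim_row Q) m \<and> B \<in> carrier_mat m (dim_col Q) \<and> Q = A * B}"

definition lower_triangular_ones :: "nat \<Rightarrow> real mat" where
  "lower_triangular_ones U = mat U U (\<lambda>(i, j). if j \<le> i then 1 else 0)"

end

theory Submission
  imports Defs "HOL-Analysis.Harmonic_Numbers" "HOL-Real_Asymp.Real_Asymp"
begin

text \<open>
  Rescale a factorization of cost \<open>\<gamma>\<close> so that the columns of \<open>B\<close> have \<open>\<ell>\<^sub>1\<close>-norm at most one, and
  restrict to \<open>2 ^ (L + 1)\<close> rows and \<open>2 ^ L\<close> columns. At a dyadic interval containing the column index
  \<open>j\<close>, the signed four-block wavelet applied to column \<open>j\<close> of \<open>Q\<close> has the sign of the next binary digit
  of \<open>j\<close> and is bounded below at all but a sixteenth of the levels. Hence the \<open>L\<close> digits of \<open>j\<close> are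
  approximated by a combination, with coefficients of total size one, of vectors \<open>u k\<close>
  whose entry at level \<open>l\<close> depends only on the digits before \<open>l\<close>, and whose total
  squared norm is on average at most \<open>4 * \<gamma>\<^sup>2\<close>. Rounding the coefficients
  at random to multiples of \<open>1 / q\<close> costs a squared error of order \<open>\<gamma>\<^sup>2 / q\<^sup>2\<close> and leaves integer labels
  of total size at most \<open>2 * q\<close>. So if \<open>\<gamma>\<^sup>2 / q\<^sup>2\<close> is a small multiple of \<open>L\<close>, a constant fraction of all \<open>j\<close> has most
  of its digits predicted online from a labelling costing \<open>O(q * ln L)\<close> bits, but any one labelling
  serves only a fraction \<open>c ^ L\<close> (with \<open>c < 1\<close>) of the \<open>j\<close>. Taking \<open>q\<close> of order \<open>L / ln L\<close> gives a contradiction unless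
  \<open>\<gamma>\<^sup>2\<close> is at least of order \<open>L ^ 3 / (ln L)\<^sup>2\<close>.
\<close>

section \<open>Rounding and counting\<close>

lemma sum_lessThan_mult:
  fixes f :: "nat \<Rightarrow> 'a::comm_monoid_add"
  shows "(\<Sum>n<a * b. f n) = (\<Sum>x<a. \<Sum>y<b. f (x * b + y))"
proof -
  have "sum f {x * b..<x * b + b} = (\<Sum>y<b. f (x * b + y))" for x
    using sum.shift_bounds_nat_ivl[of f 0 "x * b" b] by (simp add: lessThan_atLeast0 add.commute)
  then show ?thesis
    using sum.nat_group[of f b a] by simp
qed

text \<open>Randomized rounding made deterministic, one coordinate at a time: rounding
  \<open>c k\<close> up with probability equal to its fractional part is unbiased, so on average it
  adds at most a quarter of the squared norm of \<open>v k\<close> to the squared error, and the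
  expected absolute label is \<open>\<bar>c k\<bar>\<close>. The penalty \<open>\<mu>\<close> puts
  both quantities into one sum, so that a single outcome controls both.\<close>

lemma randomized_rounding:
  fixes c :: "'k \<Rightarrow> real" and v :: "'k \<Rightarrow> 'l \<Rightarrow> real"
  assumes "finite R" and "0 \<le> \<mu>"
  shows "\<exists>n :: 'k \<Rightarrow> int.
    (\<Sum>l\<in>I. (\<Sum>k\<in>R. (c k - n k) * v k l)\<^sup>2) + \<mu> * (\<Sum>k\<in>R. \<bar>real_of_int (n k)\<bar>)
    \<le> (\<Sum>k\<in>R. \<Sum>l\<in>I. (v k l)\<^sup>2) / 4 + \<mu> * (\<Sum>k\<in>R. \<bar>c k\<bar>)"
  using assms(1)
proof induction
  case empty
  then show ?case by simp
next
  case (insert k R)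
  then obtain n :: "'k \<Rightarrow> int" where
    n: "(\<Sum>l\<in>I. (\<Sum>k\<in>R. (c k - n k) * v k l)\<^sup>2) + \<mu> * (\<Sum>k\<in>R. \<bar>real_of_int (n k)\<bar>)
      \<le> (\<Sum>k\<in>R. \<Sum>l\<in>I. (v k l)\<^sup>2) / 4 + \<mu> * (\<Sum>k\<in>R. \<bar>c k\<bar>)" by blast
  define e where "e l = (\<Sum>k\<in>R. (c k - n k) * v k l)" for l
  define F where "F i = (\<Sum>l\<in>I. (e l + (c k - real_of_int i) * v k l)\<^sup>2) + \<mu> * \<bar>real_of_int i\<bar>" for i
  define V where "V = (\<Sum>l\<in>I. (v k l)\<^sup>2)"
  define p where "p = frac (c k)"
  have F: "F i = (\<Sum>l\<in>I. (e l)\<^sup>2) + 2 * (c k - i) * (\<Sum>l\<in>I. e l * v k l) + (c k - i)\<^sup>2 * V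
      + \<mu> * \<bar>real_of_int i\<bar>" for i
  proof -
    have "(e l + (c k - i) * v k l)\<^sup>2
        = (e l)\<^sup>2 + 2 * (c k - i) * (e l * v k l) + (c k - i)\<^sup>2 * (v k l)\<^sup>2" for l
      by (simp add: power2_sum power_mult_distrib)
    then show ?thesis
      by (simp add: F_def V_def sum.distrib sum_distrib_left)
  qed
  have p: "0 \<le> p" "p < 1" "c k = \<lfloor>c k\<rfloor> + p"
    by (simp_all add: p_def frac_lt_1) (simp add: frac_def)
  \<comment> \<open>The absolute value can only bend at the integer 0, so it is affine between two
    consecutive integers and rounding preserves its mean.\<close>
  have abs: "(1 - p) * \<bar>real_of_int \<lfloor>c k\<rfloor>\<bar> + p * \<bar>real_of_int (\<lfloor>c k\<rfloor> + 1)\<bar> = \<bar>c k\<bar>"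
  proof (cases "0 \<le> \<lfloor>c k\<rfloor>")
    case True
    then have "\<bar>c k\<bar> = c k" "\<bar>real_of_int \<lfloor>c k\<rfloor>\<bar> = \<lfloor>c k\<rfloor>" "\<bar>real_of_int (\<lfloor>c k\<rfloor> + 1)\<bar> = \<lfloor>c k\<rfloor> + 1"
      by simp_all
    then show ?thesis using p(3) by (simp add: algebra_simps)
  next
    case False
    then have "\<bar>c k\<bar> = - c k" "\<bar>real_of_int \<lfloor>c k\<rfloor>\<bar> = - \<lfloor>c k\<rfloor>" "\<bar>real_of_int (\<lfloor>c k\<rfloor> + 1)\<bar> = - \<lfloor>c k\<rfloor> - 1"
      by linarith+
    then show ?thesis using p(3) by (simp add: algebra_simps)
  qed
  have V0: "0 \<le> V" by (simp add: V_def sum_nonneg)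
  have "p * (1 - p) \<le> 1 / 4"
    using zero_le_power2[of "p - 1 / 2"] by (simp add: power2_eq_square algebra_simps)
  have d: "c k - real_of_int \<lfloor>c k\<rfloor> = p" "c k - real_of_int (\<lfloor>c k\<rfloor> + 1) = p - 1"
    using p(3) by linarith+
  \<comment> \<open>The cross term with \<open>e\<close> averages to zero, and the mean squared
    rounding error is \<open>p * (1 - p)\<close>.\<close>
  have "(1 - p) * F \<lfloor>c k\<rfloor> + p * F (\<lfloor>c k\<rfloor> + 1)
    = (\<Sum>l\<in>I. (e l)\<^sup>2) + p * (1 - p) * V
      + \<mu> * ((1 - p) * \<bar>real_of_int \<lfloor>c k\<rfloor>\<bar> + p * \<bar>real_of_int (\<lfloor>c k\<rfloor> + 1)\<bar>)"
    unfolding F d by (simp add: power2_eq_square algebra_simps)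
  also have "\<dots> \<le> (\<Sum>l\<in>I. (e l)\<^sup>2) + 1 / 4 * V + \<mu> * \<bar>c k\<bar>"
    unfolding abs using mult_right_mono[OF \<open>p * (1 - p) \<le> 1 / 4\<close> V0] by simp
  finally have avg: "(1 - p) * F \<lfloor>c k\<rfloor> + p * F (\<lfloor>c k\<rfloor> + 1) \<le> (\<Sum>l\<in>I. (e l)\<^sup>2) + V / 4 + \<mu> * \<bar>c k\<bar>"
    by simp
  define B where "B = (\<Sum>l\<in>I. (e l)\<^sup>2) + V / 4 + \<mu> * \<bar>c k\<bar>"
  have "\<exists>i. F i \<le> B"
  proof (rule ccontr)
    assume "\<not> ?thesis"
    then have "B < F \<lfloor>c k\<rfloor>" "B < F (\<lfloor>c k\<rfloor> + 1)" by (simp_all add: not_le)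
    then have "(1 - p) * B < (1 - p) * F \<lfloor>c k\<rfloor>" "p * B \<le> p * F (\<lfloor>c k\<rfloor> + 1)"
      using p by (simp_all add: mult_left_mono)
    moreover have "(1 - p) * B + p * B = B" by (simp add: algebra_simps)
    ultimately show False using avg unfolding B_def[symmetric] by linarith
  qed
  then obtain i where i: "F i \<le> B" by blast
  define n' where "n' = n(k := i)"
  have "(\<Sum>k'\<in>R. (c k' - n' k') * v k' l) = e l" for l
    unfolding e_def n'_def using insert.hyps by (intro sum.cong) auto
  moreover have "(\<Sum>k'\<in>R. \<bar>real_of_int (n' k')\<bar>) = (\<Sum>k'\<in>R. \<bar>real_of_int (n k')\<bar>)"
    unfolding n'_def using insert.hyps by (intro sum.cong) auto
  moreover have "n' k = i" by (simp add: n'_def)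
  ultimately have "(\<Sum>l\<in>I. (\<Sum>k\<in>insert k R. (c k - n' k) * v k l)\<^sup>2)
      + \<mu> * (\<Sum>k\<in>insert k R. \<bar>real_of_int (n' k)\<bar>) = F i + \<mu> * (\<Sum>k\<in>R. \<bar>real_of_int (n k)\<bar>)"
    unfolding sum.insert[OF insert.hyps] by (simp add: F_def distrib_left add.commute)
  then show ?case
    using i n insert.hyps by (intro exI[of _ n']) (simp add: e_def V_def B_def algebra_simps add_divide_distrib)
qed

text \<open>The fixed product weight makes one labelling \<open>f\<close> serve all paths, although the set \<open>S g\<close> of
  relevant coordinates varies with the path: the irrelevant coordinates integrate to one.\<close>

lemma product_weight_double_counting:
  fixes w :: "'i \<Rightarrow> real"
  assumes "finite K" "finite I" "finite G"
    and w: "\<And>i. i \<in> I \<Longrightarrow> 0 \<le> w i" "(\<Sum>i\<in>I. w i) = 1"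
    and S: "\<And>g. g \<in> G \<Longrightarrow> S g \<subseteq> K" "\<And>g k. g \<in> G \<Longrightarrow> k \<in> S g \<Longrightarrow> n g k \<in> I"
    and \<eta>: "\<And>g. g \<in> G \<Longrightarrow> \<eta> \<le> (\<Prod>k\<in>S g. w (n g k))"
    and good: "\<And>g f. g \<in> G \<Longrightarrow> f \<in> K \<rightarrow>\<^sub>E I \<Longrightarrow> (\<And>k. k \<in> S g \<Longrightarrow> f k = n g k) \<Longrightarrow> P f g"
    and C: "\<And>f. f \<in> K \<rightarrow>\<^sub>E I \<Longrightarrow> real (card {g \<in> G. P f g}) \<le> C"
  shows "real (card G) * \<eta> \<le> C"
proof -
  define W where "W f = (\<Prod>k\<in>K. w (f k))" for f
  have W0: "0 \<le> W f" if "f \<in> K \<rightarrow>\<^sub>E I" for f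
    unfolding W_def using that w(1) by (intro prod_nonneg) auto
  have fin: "finite (K \<rightarrow>\<^sub>E I)" using assms(1,2) by (intro finite_PiE) auto
  have "real (card G) * \<eta> \<le> (\<Sum>g\<in>G. \<Prod>k\<in>S g. w (n g k))"
    using sum_bounded_below[of G \<eta>] \<eta> by simp
  also have "\<dots> \<le> (\<Sum>g\<in>G. \<Sum>f\<in>{f \<in> K \<rightarrow>\<^sub>E I. P f g}. W f)"
  proof (rule sum_mono)
    fix g assume g: "g \<in> G"
    let ?J = "\<lambda>k. if k \<in> S g then {n g k} else I"
    have "(\<Prod>k\<in>S g. w (n g k)) = (\<Prod>k\<in>K. if k \<in> S g then w (n g k) else 1)"
      using S(1)[OF g] assms(1) by (simp add: prod.If_cases Int_absorb1)
    also have "\<dots> = (\<Prod>k\<in>K. \<Sum>i\<in>?J k. w i)"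
      using w(2) by (intro prod.cong) auto
    also have "\<dots> = (\<Sum>f\<in>Pi\<^sub>E K ?J. W f)"
      unfolding W_def using assms(1,2) by (intro prod_sum_PiE) auto
    also have "\<dots> \<le> (\<Sum>f\<in>{f \<in> K \<rightarrow>\<^sub>E I. P f g}. W f)"
    proof (rule sum_mono2)
      have "f \<in> K \<rightarrow>\<^sub>E I \<and> P f g" if f: "f \<in> Pi\<^sub>E K ?J" for f
      proof
        show fI: "f \<in> K \<rightarrow>\<^sub>E I"
        proof (rule PiE_I)
          show "f k \<in> I" if "k \<in> K" for k
            using PiE_mem[OF f that] S(2)[OF g, of k] by (cases "k \<in> S g") simp_all
          show "f k = undefined" if "k \<notin> K" for k
            using f that by (rule PiE_arb)
        qed
        have "f k = n g k" if "k \<in> S g" for k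
          using PiE_mem[OF f, of k] S(1)[OF g] that by auto
        then show "P f g" by (rule good[OF g fI])
      qed
      then show "Pi\<^sub>E K ?J \<subseteq> {f \<in> K \<rightarrow>\<^sub>E I. P f g}" by blast
    qed (use fin W0 in auto)
    finally show "(\<Prod>k\<in>S g. w (n g k)) \<le> (\<Sum>f\<in>{f \<in> K \<rightarrow>\<^sub>E I. P f g}. W f)" .
  qed
  also have "\<dots> = (\<Sum>f\<in>K \<rightarrow>\<^sub>E I. \<Sum>g\<in>{g \<in> G. P f g}. W f)"
    by (rule sum.swap_restrict[OF assms(3) fin])
  also have "\<dots> \<le> (\<Sum>f\<in>K \<rightarrow>\<^sub>E I. W f * C)"
    using C W0 by (intro sum_mono) (simp add: mult.commute[of _ "W _"] mult_left_mono)
  also have "\<dots> = (\<Prod>k\<in>K. \<Sum>i\<in>I. w i) * C"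
    unfolding W_def using prod_sum_PiE[of K "\<lambda>_. I" "\<lambda>_. w"] assms(1,2)
    by (simp add: sum_distrib_right[symmetric])
  finally show ?thesis using w(2) by simp
qed

section \<open>Prediction along the paths of a binary tree\<close>

text \<open>\<open>P l\<close> sees the \<open>l\<close> leading digits of the
  \<open>L\<close>-digit number \<open>x\<close>, as the node \<open>x div 2 ^ (L - l)\<close>, and
  guesses the next digit, \<open>True\<close> standing for 1. Level 0 is the most significant
  digit.\<close>

definition mistakes :: "(nat \<Rightarrow> nat \<Rightarrow> bool) \<Rightarrow> nat \<Rightarrow> nat \<Rightarrow> nat set" where
  "mistakes P L x = {l. l < L \<and> P l (x div 2 ^ (L - l)) \<noteq> odd (x div 2 ^ (L - 1 - l))}"

lemma finite_mistakes [simp]: "finite (mistakes P L x)"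
  by (simp add: mistakes_def)

lemma card_mistakes_Suc:
  "card (mistakes P (Suc L) x) = card (mistakes P L (x div 2)) + (if P L (x div 2) \<noteq> odd x then 1 else 0)"
proof -
  have mem: "l \<in> mistakes P (Suc L) x \<longleftrightarrow> l \<in> mistakes P L (x div 2)" if "l < L" for l
  proof -
    have "Suc L - l = Suc (L - l)" "Suc L - 1 - l = Suc (L - 1 - l)" using that by auto
    then have eqs: "x div 2 ^ (Suc L - l) = x div 2 div 2 ^ (L - l)"
      "x div 2 ^ (Suc L - 1 - l) = x div 2 div 2 ^ (L - 1 - l)"
      by (simp_all only: power_Suc div_mult2_eq)
    show ?thesis unfolding mistakes_def mem_Collect_eq eqs using that by (meson less_SucI)
  qed
  have "mistakes P (Suc L) x
      = mistakes P L (x div 2) \<union> (if P L (x div 2) \<noteq> odd x then {L} else {})"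
  proof (rule Set.set_eqI)
    fix l
    consider "l < L" | "l = L" | "L < l" by linarith
    then show "l \<in> mistakes P (Suc L) x
        \<longleftrightarrow> l \<in> mistakes P L (x div 2) \<union> (if P L (x div 2) \<noteq> odd x then {L} else {})"
    proof cases
      case 1
      then show ?thesis using mem[of l] by simp
    qed (simp_all add: mistakes_def)
  qed
  moreover have "L \<notin> mistakes P L (x div 2)" by (simp add: mistakes_def)
  ultimately show ?thesis by simp
qed

text \<open>The two children of a node receive the same guess, which is wrong for exactly one of
  them. Each level hence contributes a factor \<open>1 + \<rho>\<close>, whatever the strategy
  \<open>P\<close> is.\<close>

lemma sum_power_mistakes:
  fixes \<rho> :: real
  shows "(\<Sum>x<2 ^ L. \<rho> ^ card (mistakes P L x)) = (1 + \<rho>) ^ L"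
proof (induction L)
  case 0
  then show ?case by (simp add: mistakes_def)
next
  case (Suc L)
  have "(\<Sum>x<2 ^ Suc L. \<rho> ^ card (mistakes P (Suc L) x))
      = (\<Sum>x<2 ^ L. \<Sum>y<2. \<rho> ^ card (mistakes P (Suc L) (x * 2 + y)))"
    using sum_lessThan_mult[of _ "2 ^ L" 2] by (simp add: mult.commute)
  also have "\<dots> = (\<Sum>x<2 ^ L. (1 + \<rho>) * \<rho> ^ card (mistakes P L x))"
    by (intro sum.cong) (auto simp: lessThan_nat_numeral lessThan_Suc card_mistakes_Suc algebra_simps)
  finally show ?case using Suc by (simp add: sum_distrib_left[symmetric])
qed

text \<open>Exponential moment bound with \<open>\<rho> = 1 / 2\<close>. The base
  \<open>3 / 2 * 2 powr (1 / 4)\<close> is below 2, so any one strategy does well only on an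
  exponentially small fraction of the paths.\<close>

lemma card_few_mistakes:
  "real (card {x. x < 2 ^ L \<and> 4 * card (mistakes P L x) \<le> L}) \<le> (3 / 2) ^ L * 2 powr (L / 4)"
proof -
  let ?X = "{x. x < 2 ^ L \<and> 4 * card (mistakes P L x) \<le> L}"
  have "2 powr (- (L / 4)) \<le> (1 / 2) ^ card (mistakes P L x)" if "x \<in> ?X" for x
  proof -
    have "real (card (mistakes P L x)) \<le> L / 4" using that by simp
    then have "2 powr (- (L / 4)) \<le> 2 powr (- real (card (mistakes P L x)))" by simp
    also have "\<dots> = (1 / 2) ^ card (mistakes P L x)"
      by (simp add: powr_minus_divide powr_realpow power_one_over)
    finally show ?thesis .
  qed
  then have "real (card ?X) * 2 powr (- (L / 4)) \<le> (\<Sum>x\<in>?X. (1 / 2) ^ card (mistakes P L x))"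
    using sum_bounded_below[of ?X "2 powr (- (L / 4))"] by simp
  also have "\<dots> \<le> (\<Sum>x<2 ^ L. (1 / 2) ^ card (mistakes P L x))"
    by (intro sum_mono2) auto
  also have "\<dots> = (3 / 2) ^ L" by (simp add: sum_power_mistakes)
  finally show ?thesis by (simp add: powr_minus_divide pos_divide_le_eq)
qed

section \<open>Wavelets on dyadic intervals\<close>

definition block_sum :: "(nat \<Rightarrow> real) \<Rightarrow> nat \<Rightarrow> nat \<Rightarrow> real" where
  "block_sum a r x = (\<Sum>i<r. a (x * r + i))"

text \<open>The signs +, -, -, + run over the quarters of the \<open>x\<close>-th interval of length
  \<open>4 * r\<close>. Unlike a two-block Haar function, this gives a step opposite signs according
  to the half in which it jumps. The divisor \<open>2 * r\<close> keeps the coefficients of a unit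
  step of the same order at every scale.\<close>

definition wavelet :: "(nat \<Rightarrow> real) \<Rightarrow> nat \<Rightarrow> nat \<Rightarrow> real" where
  "wavelet a r x = (block_sum a r (4 * x) - block_sum a r (4 * x + 1)
    - block_sum a r (4 * x + 2) + block_sum a r (4 * x + 3)) / (2 * r)"

lemma block_sum_linear:
  "block_sum (\<lambda>i. \<Sum>k\<in>K. b k * a k i) r x = (\<Sum>k\<in>K. b k * block_sum (a k) r x)"
  unfolding block_sum_def sum_distrib_left by (rule sum.swap)

lemma wavelet_linear:
  "wavelet (\<lambda>i. \<Sum>k\<in>K. b k * a k i) r x = (\<Sum>k\<in>K. b k * wavelet (a k) r x)"
  by (simp only: wavelet_def block_sum_linear times_divide_eq_right sum_divide_distrib[symmetric]
    distrib_left right_diff_distrib sum.distrib sum_subtractf)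

lemma wavelet_cong:
  assumes "\<And>i. i < (x + 1) * (4 * r) \<Longrightarrow> a i = a' i"
  shows "wavelet a r x = wavelet a' r x"
proof -
  have "block_sum a r (4 * x + c) = block_sum a' r (4 * x + c)" if c: "c < 4" for c
    unfolding block_sum_def
  proof (intro sum.cong refl assms)
    fix i assume "i \<in> {..<r}"
    then have "(4 * x + c) * r + i < (4 * x + c + 1) * r" by simp
    also have "\<dots> \<le> (4 * x + 4) * r" using c by (intro mult_right_mono) auto
    finally show "(4 * x + c) * r + i < (x + 1) * (4 * r)" by (simp add: algebra_simps)
  qed
  from this[of 0] this[of 1] this[of 2] this[of 3] show ?thesis
    by (simp add: wavelet_def)
qed

lemma block_sum_double:
  "block_sum a (2 * r) x = block_sum a r (2 * x) + block_sum a r (2 * x + 1)"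
proof -
  have e: "2 * x * r = x * (2 * r)" "(2 * x + 1) * r = x * (2 * r) + r" by simp_all
  have "block_sum a (2 * r) x = (\<Sum>y<2. \<Sum>i<r. a (x * (2 * r) + (y * r + i)))"
    unfolding block_sum_def by (rule sum_lessThan_mult)
  also have "\<dots> = (\<Sum>i<r. a (x * (2 * r) + i)) + (\<Sum>i<r. a (x * (2 * r) + (r + i)))"
    by (simp add: numeral_2_eq_2)
  finally show ?thesis by (simp only: block_sum_def e add.assoc)
qed

section \<open>Energy of Haar and wavelet coefficients\<close>

text \<open>Bessel's inequality for the Haar system. \<open>S e\<close> is the energy of the
  projection onto functions constant on blocks of length \<open>2 ^ e\<close>; the parallelogram
  identity writes the energy of one scale as \<open>S e - S (Suc e)\<close>, and the sum
  telescopes.\<close>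

lemma sum_dyadic_differences:
  "(\<Sum>e<n. (\<Sum>x<2 ^ (n - 1 - e). (block_sum a (2 ^ e) (2 * x + 1) - block_sum a (2 ^ e) (2 * x))\<^sup>2) / 2 ^ (e + 1))
    \<le> (\<Sum>i<2 ^ n. (a i)\<^sup>2)"
proof -
  define S where "S e = (\<Sum>x<2 ^ (n - e). (block_sum a (2 ^ e) x)\<^sup>2) / 2 ^ e" for e
  have step: "(\<Sum>x<2 ^ (n - 1 - e). (block_sum a (2 ^ e) (2 * x + 1) - block_sum a (2 ^ e) (2 * x))\<^sup>2) / 2 ^ (e + 1)
      = S e - S (Suc e)" if "e < n" for e
  proof -
    let ?b = "block_sum a (2 ^ e)"
    have n: "n - e = Suc (n - 1 - e)" "n - Suc e = n - 1 - e" using that by auto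
    have "(\<Sum>x<2 ^ (n - e). (?b x)\<^sup>2) = (\<Sum>x<2 ^ (n - 1 - e). (?b (2 * x))\<^sup>2 + (?b (2 * x + 1))\<^sup>2)"
      using sum_lessThan_mult[of "\<lambda>x. (?b x)\<^sup>2" "2 ^ (n - 1 - e)" 2]
      by (simp only: n power_Suc) (simp add: lessThan_nat_numeral lessThan_Suc mult.commute add.commute)
    moreover have "(\<Sum>x<2 ^ (n - Suc e). (block_sum a (2 ^ Suc e) x)\<^sup>2)
        = (\<Sum>x<2 ^ (n - 1 - e). (?b (2 * x) + ?b (2 * x + 1))\<^sup>2)"
      by (simp only: n power_Suc block_sum_double)
    moreover have "(p - q)\<^sup>2 / 2 ^ (e + 1) = (q\<^sup>2 + p\<^sup>2) / 2 ^ e - (q + p)\<^sup>2 / 2 ^ Suc e" for p q :: real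
      by (simp add: power2_eq_square field_simps)
    ultimately show ?thesis
      by (simp only: S_def sum_divide_distrib sum_subtractf[symmetric])
  qed
  have "(\<Sum>e<n. (\<Sum>x<2 ^ (n - 1 - e). (block_sum a (2 ^ e) (2 * x + 1) - block_sum a (2 ^ e) (2 * x))\<^sup>2) / 2 ^ (e + 1))
      = S 0 - S n"
    using sum_lessThan_telescope'[of S n] step by simp
  also have "\<dots> \<le> S 0" by (simp add: S_def sum_nonneg)
  also have "S 0 = (\<Sum>i<2 ^ n. (a i)\<^sup>2)" by (simp add: S_def block_sum_def)
  finally show ?thesis .
qed

text \<open>A wavelet coefficient is a multiple of the difference of the Haar differences on the two
  halves of its interval. A node of scale \<open>e\<close> lies on \<open>2 ^ (e + 1)\<close> paths
  \<open>x\<close>, and this multiplicity absorbs the normalization, so the sum over all paths is at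
  most twice the Haar energy.\<close>

lemma wavelet_energy:
  "(\<Sum>x<2 ^ L. \<Sum>l<L. (wavelet a (2 ^ (L - 1 - l)) (x div 2 ^ (L - l)))\<^sup>2) \<le> 2 * (\<Sum>i<2 ^ (L + 1). (a i)\<^sup>2)"
proof -
  let ?D = "\<lambda>e x. block_sum a (2 ^ e) (2 * x + 1) - block_sum a (2 ^ e) (2 * x)"
  have sq: "(wavelet a (2 ^ e) x)\<^sup>2 \<le> ((?D e (2 * x))\<^sup>2 + (?D e (2 * x + 1))\<^sup>2) / 2 / (2 ^ e)\<^sup>2" for e x
  proof -
    have "wavelet a (2 ^ e) x = (?D e (2 * x + 1) - ?D e (2 * x)) / (2 * 2 ^ e)"
      by (simp add: wavelet_def algebra_simps eval_nat_numeral)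
    moreover have "((p - q) / (2 * s))\<^sup>2 \<le> (q\<^sup>2 + p\<^sup>2) / 2 / s\<^sup>2" for p q s :: real
    proof -
      have "(p - q)\<^sup>2 / 4 \<le> (q\<^sup>2 + p\<^sup>2) / 2"
        using zero_le_power2[of "p + q"] by (simp add: power2_eq_square algebra_simps)
      then have "(p - q)\<^sup>2 / 4 / s\<^sup>2 \<le> (q\<^sup>2 + p\<^sup>2) / 2 / s\<^sup>2"
        by (rule divide_right_mono) simp
      then show ?thesis by (simp add: power_divide power_mult_distrib)
    qed
    ultimately show ?thesis by simp
  qed
  have level: "(\<Sum>x<2 ^ L. (wavelet a (2 ^ e) (x div 2 ^ Suc e))\<^sup>2)
      \<le> 2 * ((\<Sum>x<2 ^ (L - e). (?D e x)\<^sup>2) / 2 ^ (e + 1))" if "e < L" for e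
  proof -
    have L: "(2::nat) ^ L = 2 ^ (L - Suc e) * 2 ^ Suc e" "(2::nat) ^ (L - e) = 2 ^ (L - Suc e) * 2"
      using that by (simp_all only: power_add[symmetric] power_Suc2[symmetric]) (simp_all add: Suc_diff_Suc)
    have "(\<Sum>x<2 ^ L. (wavelet a (2 ^ e) (x div 2 ^ Suc e))\<^sup>2)
        = (\<Sum>x<2 ^ (L - Suc e). 2 * 2 ^ e * (wavelet a (2 ^ e) x)\<^sup>2)"
      unfolding L(1) sum_lessThan_mult by (intro sum.cong refl) simp
    also have "\<dots> \<le> (\<Sum>x<2 ^ (L - Suc e). 2 * 2 ^ e * (((?D e (2 * x))\<^sup>2 + (?D e (2 * x + 1))\<^sup>2) / 2 / (2 ^ e)\<^sup>2))"
      by (intro sum_mono mult_left_mono sq) simp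
    also have "\<dots> = (\<Sum>x<2 ^ (L - Suc e). ((?D e (2 * x))\<^sup>2 + (?D e (2 * x + 1))\<^sup>2) / 2 ^ e)"
      by (intro sum.cong refl) (simp add: power2_eq_square)
    also have "\<dots> = (\<Sum>x<2 ^ (L - e). (?D e x)\<^sup>2) / 2 ^ e"
      unfolding L(2) sum_lessThan_mult
      by (simp add: lessThan_nat_numeral lessThan_Suc sum_divide_distrib mult.commute add.commute)
    finally show ?thesis by simp
  qed
  have "(\<Sum>x<2 ^ L. \<Sum>l<L. (wavelet a (2 ^ (L - 1 - l)) (x div 2 ^ (L - l)))\<^sup>2)
      = (\<Sum>l<L. \<Sum>x<2 ^ L. (wavelet a (2 ^ (L - Suc l)) (x div 2 ^ Suc (L - Suc l)))\<^sup>2)"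
    by (subst sum.swap) (intro sum.cong refl, simp add: Suc_diff_Suc)
  also have "\<dots> = (\<Sum>e<L. \<Sum>x<2 ^ L. (wavelet a (2 ^ e) (x div 2 ^ Suc e))\<^sup>2)"
    by (rule sum.nat_diff_reindex)
  also have "\<dots> \<le> (\<Sum>e<L. 2 * ((\<Sum>x<2 ^ (L - e). (?D e x)\<^sup>2) / 2 ^ (e + 1)))"
    using level by (intro sum_mono) simp
  also have "\<dots> \<le> 2 * (\<Sum>e<L + 1. (\<Sum>x<2 ^ (L + 1 - 1 - e). (?D e x)\<^sup>2) / 2 ^ (e + 1))"
    unfolding sum_distrib_left[symmetric] by (simp add: sum_nonneg)
  also have "\<dots> \<le> 2 * (\<Sum>i<2 ^ (L + 1). (a i)\<^sup>2)"
    using sum_dyadic_differences[of a "L + 1"] by simp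
  finally show ?thesis .
qed

section \<open>Wavelet coefficients of a step\<close>

lemma block_sum_step:
  assumes "y < r"
  shows "block_sum (\<lambda>i. if J * r + y \<le> i then 1 else 0) r x
    = (if J < x then real r else if J = x then real r - real y else 0)"
proof -
  have "block_sum (\<lambda>i. if J * r + y \<le> i then 1 else 0) r x = real (card {i. i < r \<and> J * r + y \<le> x * r + i})"
    by (simp add: block_sum_def sum.If_cases Int_def)
  also have "{i. i < r \<and> J * r + y \<le> x * r + i} = (if J < x then {..<r} else if J = x then {y..<r} else {})"
  proof -
    consider "J < x" | "J = x" | "x < J" by linarith
    then show ?thesis
    proof cases
      case 1
      then have "(J + 1) * r \<le> x * r" by (intro mult_right_mono) auto
      with 1 assms show ?thesis by auto
    next
      case 2
      then show ?thesis by auto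
    next
      case 3
      then have "(x + 1) * r \<le> J * r" by (intro mult_right_mono) auto
      with 3 show ?thesis by auto
    qed
  qed
  finally show ?thesis using assms by (auto simp: of_nat_diff)
qed

text \<open>As a function of the jump \<open>j\<close>, the coefficient is a negative tent over the
  left half of the interval and a positive tent over the right half. So its sign reveals the binary
  digit of \<open>j\<close> that selects the half, and its size is the relative distance of
  \<open>j\<close> to the nearer end of that half.\<close>

lemma wavelet_step:
  assumes "0 < r"
  shows "(if odd (j div (2 * r)) then 1 else - 1) * wavelet (\<lambda>i. if j \<le> i then 1 else 0) r (j div (4 * r))
    = real (min (j mod (2 * r)) (2 * r - j mod (2 * r))) / (2 * r)"
proof -
  define J y where "J = j div r" and "y = j mod r"
  have y: "y < r" using assms by (simp add: y_def)
  have d: "j div (2 * r) = J div 2" "j div (4 * r) = J div 4"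
    by (simp_all add: J_def div_mult2_eq[symmetric] mult.commute)
  have m: "j mod (2 * r) = r * (J mod 2) + y"
    unfolding J_def y_def by (subst mult.commute) (simp add: mod_mult2_eq)
  \<comment> \<open>\<open>x\<close> is the interval of length \<open>4 * r\<close> containing
    \<open>j\<close>, and \<open>c\<close> the quarter of it that holds \<open>j\<close>.\<close>
  obtain x c where J: "J = 4 * x + c" and c: "c < 4"
    by (metis mod_less_divisor mult_div_mod_eq zero_less_numeral)
  have J2: "J = c + 2 * (2 * x)" by (simp add: J)
  have Jc: "J div 4 = x" "J div 2 = 2 * x + c div 2" "J mod 2 = c mod 2"
    using c by (simp add: J) (simp_all only: J2 div_mult_self2 mod_mult_self2 zero_neq_numeral not_False_eq_True)
  have j: "j = J * r + y" by (simp add: J_def y_def)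
  have bs: "block_sum (\<lambda>i. if j \<le> i then 1 else 0) r (4 * x + c')
      = (if c < c' then real r else if c = c' then real r - real y else 0)" for c'
    unfolding j block_sum_step[OF y] J by simp
  have w: "wavelet (\<lambda>i. if j \<le> i then 1 else 0) r x
      = (if c = 0 then - real y else if c = 1 then real y - real r else if c = 2 then real y else real r - real y) / (2 * r)"
    using c bs[of 0] bs[of 1] bs[of 2] bs[of 3] unfolding wavelet_def by (simp split: if_splits)
  have mins: "min y (2 * r - y) = y" "min (r + y) (r - y) = r - y"
    using y by linarith+
  have "c = 0 \<or> c = 1 \<or> c = 2 \<or> c = 3" using c by linarith
  then have "(if odd (c div 2) then 1 else - 1)
      * (if c = 0 then - real y else if c = 1 then real y - real r else if c = 2 then real y else real r - real y)
      = real (min (r * (c mod 2) + y) (2 * r - (r * (c mod 2) + y)))"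
    using mins y by (elim disjE) (simp_all add: of_nat_diff)
  then show ?thesis unfolding d m Jc w by simp
qed

text \<open>The odd position \<open>2 * x + 1\<close> has distance at least one from the ends of its
  half. This keeps the bound true for \<open>r < 32\<close>, where \<open>r div 32 = 0\<close> and
  no residue is excluded.\<close>

lemma wavelet_step_ge:
  assumes "0 < r" and x: "x mod r \<in> {r div 32..<r - r div 32}"
  shows "1 / 64 \<le> (if odd (x div r) then 1 else - 1)
    * wavelet (\<lambda>i. if 2 * x + 1 \<le> i then 1 else 0) r (x div (2 * r))"
proof -
  have d: "(2 * x + 1) div (2 * r) = x div r" "(2 * x + 1) div (4 * r) = x div (2 * r)"
    using div_mult2_eq[of "2 * x + 1" 2 r] div_mult2_eq[of "2 * x + 1" 2 "2 * r"] by simp_all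
  have m: "(2 * x + 1) mod (2 * r) = 2 * (x mod r) + 1"
    using mod_mult2_eq[of "2 * x + 1" 2 r] by simp
  have "r < 32 * (r div 32) + 32" using dividend_less_div_times[of 32 r] by simp
  then have "r \<le> 32 * min (2 * (x mod r) + 1) (2 * r - (2 * (x mod r) + 1))"
    using x by (auto simp: min_def)
  then have "real r \<le> 32 * real (min (2 * (x mod r) + 1) (2 * r - (2 * (x mod r) + 1)))"
    by (metis of_nat_le_iff of_nat_mult of_nat_numeral)
  then have "1 / 64 \<le> real (min (2 * (x mod r) + 1) (2 * r - (2 * (x mod r) + 1))) / (2 * r)"
    using assms(1) by (simp add: pos_le_divide_eq)
  then show ?thesis
    by (simp only: wavelet_step[OF assms(1), of "2 * x + 1", unfolded d m])
qed

text \<open>With \<open>r = 2 ^ (L - 1 - l)\<close>, level \<open>l\<close> excludes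
  \<open>r div 32\<close> residues at either end, at most a sixteenth of all, and
  \<open>x mod r\<close> is uniformly distributed because \<open>r\<close> divides
  \<open>2 ^ L\<close>.\<close>

lemma sum_card_extreme_levels:
  "(\<Sum>x<(2::nat) ^ L. real (card {l. l < L \<and> x mod 2 ^ (L - 1 - l) \<notin> {2 ^ (L - 1 - l) div 32..<2 ^ (L - 1 - l) - 2 ^ (L - 1 - l) div 32}}))
    \<le> real L * 2 ^ L / 16"
proof -
  let ?B = "\<lambda>r. {r div 32..<r - r div 32} :: nat set"
  have level: "(\<Sum>x<(2::nat) ^ L. if x mod 2 ^ e \<notin> ?B (2 ^ e) then 1 else 0 :: real) \<le> 2 ^ L / 16" if "e < L" for e
  proof -
    define r where "r = (2::nat) ^ e"
    have L: "(2::nat) ^ L = 2 ^ (L - e) * r"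
      using that by (simp add: r_def power_add[symmetric])
    have "{y. y < r \<and> y \<notin> ?B r} = {..<r div 32} \<union> {r - r div 32..<r}" by auto
    then have "card {y. y < r \<and> y \<notin> ?B r} \<le> r div 32 + r div 32"
      using card_Un_le[of "{..<r div 32}" "{r - r div 32..<r}"] by simp
    then have c: "real (card {y. y < r \<and> y \<notin> ?B r}) \<le> real r / 16"
      by linarith
    have "(\<Sum>x<(2::nat) ^ L. if x mod r \<notin> ?B r then 1 else 0 :: real)
        = (\<Sum>x<(2::nat) ^ (L - e). \<Sum>y<r. if y \<notin> ?B r then 1 else 0)"
      unfolding L sum_lessThan_mult by (intro sum.cong refl) simp
    also have "\<dots> = 2 ^ (L - e) * real (card {y. y < r \<and> y \<notin> ?B r})"
      by (simp add: sum.If_cases Int_def)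
    also have "\<dots> \<le> 2 ^ (L - e) * (real r / 16)" using c by (intro mult_left_mono) auto
    also have "\<dots> = 2 ^ L / 16" using arg_cong[OF L, of real] by simp
    finally show ?thesis by (simp add: r_def)
  qed
  have count: "real (card {l. l < L \<and> P l}) = (\<Sum>l<L. if P l then 1 else 0)" for P
    by (simp add: sum.If_cases Int_def)
  have "(\<Sum>x<(2::nat) ^ L. real (card {l. l < L \<and> x mod 2 ^ (L - 1 - l) \<notin> ?B (2 ^ (L - 1 - l))}))
      = (\<Sum>x<2 ^ L. \<Sum>l<L. if x mod 2 ^ (L - 1 - l) \<notin> ?B (2 ^ (L - 1 - l)) then 1 else 0)"
    by (simp only: count)
  also have "\<dots> = (\<Sum>l<L. \<Sum>x<2 ^ L. if x mod 2 ^ (L - 1 - l) \<notin> ?B (2 ^ (L - 1 - l)) then 1 else 0)"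
    by (rule sum.swap)
  also have "\<dots> \<le> (\<Sum>l<L. 2 ^ L / 16)"
    by (intro sum_mono level) auto
  finally show ?thesis by simp
qed

section \<open>Online prediction of binary digits\<close>

text \<open>The node \<open>x\<close> has depth \<open>l\<close>, and
  \<open>x div 2 ^ (l - i)\<close> is its ancestor at depth \<open>i\<close>: \<open>k\<close> is
  relevant once its energy along the path from the root reaches 1. The node alone decides this, so a
  predictor may use it, and a path of total energy \<open>E\<close> meets at most \<open>E\<close>
  relevant coordinates.\<close>

definition relevant :: "('k \<Rightarrow> nat \<Rightarrow> nat \<Rightarrow> real) \<Rightarrow> 'k \<Rightarrow> nat \<Rightarrow> nat \<Rightarrow> bool" where
  "relevant u k l x \<longleftrightarrow> 1 \<le> (\<Sum>i\<le>l. (u k i (x div 2 ^ (l - i)))\<^sup>2)"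

definition predictor :: "('k \<Rightarrow> nat \<Rightarrow> nat \<Rightarrow> real) \<Rightarrow> 'k set \<Rightarrow> ('k \<Rightarrow> int) \<Rightarrow> nat \<Rightarrow> nat \<Rightarrow> bool" where
  "predictor u K f l x \<longleftrightarrow> 0 < (\<Sum>k\<in>K. if relevant u k l x then f k * u k l x else 0)"

lemma relevant_path:
  assumes "l \<le> L"
  shows "relevant u k l (x div 2 ^ (L - l)) \<longleftrightarrow> 1 \<le> (\<Sum>i\<le>l. (u k i (x div 2 ^ (L - i)))\<^sup>2)"
proof -
  have "x div 2 ^ (L - l) div 2 ^ (l - i) = x div 2 ^ (L - i)" if "i \<le> l" for i
    using that assms by (simp add: div_mult2_eq[symmetric] power_add[symmetric])
  then show ?thesis unfolding relevant_def by simp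
qed

text \<open>Jensen's inequality for weights of total mass at most one, obtained from Cauchy-Schwarz
  by splitting \<open>b k\<close> into two factors of size
  \<open>sqrt \<bar>b k\<bar>\<close>.\<close>

lemma sum_weighted_square_le:
  fixes b z :: "'k \<Rightarrow> real"
  assumes "(\<Sum>k\<in>K. \<bar>b k\<bar>) \<le> 1"
  shows "(\<Sum>k\<in>K. b k * z k)\<^sup>2 \<le> (\<Sum>k\<in>K. \<bar>b k\<bar> * (z k)\<^sup>2)"
proof -
  have "sqrt \<bar>b k\<bar> * (sgn (b k) * sqrt \<bar>b k\<bar> * z k) = sgn (b k) * (sqrt \<bar>b k\<bar> * sqrt \<bar>b k\<bar>) * z k" for k
    by (simp only: ac_simps)
  then have "sqrt \<bar>b k\<bar> * (sgn (b k) * sqrt \<bar>b k\<bar> * z k) = b k * z k" for k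
    by (simp add: sgn_mult_abs)
  then have "(\<Sum>k\<in>K. b k * z k)\<^sup>2 = (\<Sum>k\<in>K. sqrt \<bar>b k\<bar> * (sgn (b k) * sqrt \<bar>b k\<bar> * z k))\<^sup>2"
    by (simp only:)
  also have "\<dots> \<le> (\<Sum>k\<in>K. (sqrt \<bar>b k\<bar>)\<^sup>2) * (\<Sum>k\<in>K. (sgn (b k) * sqrt \<bar>b k\<bar> * z k)\<^sup>2)"
    by (rule Cauchy_Schwarz_ineq_sum)
  also have "(\<Sum>k\<in>K. (sgn (b k) * sqrt \<bar>b k\<bar> * z k)\<^sup>2) = (\<Sum>k\<in>K. \<bar>b k\<bar> * (z k)\<^sup>2)"
    by (intro sum.cong refl) (simp add: power_mult_distrib sgn_if)
  also have "(\<Sum>k\<in>K. (sqrt \<bar>b k\<bar>)\<^sup>2) * (\<Sum>k\<in>K. \<bar>b k\<bar> * (z k)\<^sup>2) \<le> 1 * (\<Sum>k\<in>K. \<bar>b k\<bar> * (z k)\<^sup>2)"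
    using assms by (intro mult_right_mono) (auto intro: sum_nonneg)
  finally show ?thesis by simp
qed

text \<open>Partial energies increase, so the levels that count form an initial segment, and at its
  last level the accumulated energy is still below 1. This bounds what is lost by ignoring a
  coordinate until it is relevant.\<close>

lemma sum_before_threshold_le:
  fixes U :: "nat \<Rightarrow> real"
  shows "(\<Sum>l<L. if 1 \<le> (\<Sum>i\<le>l. (U i)\<^sup>2) then 0 else (U l)\<^sup>2) \<le> 1"
proof -
  define A where "A = {l. l < L \<and> \<not> 1 \<le> (\<Sum>i\<le>l. (U i)\<^sup>2)}"
  have eq: "(\<Sum>l<L. if 1 \<le> (\<Sum>i\<le>l. (U i)\<^sup>2) then 0 else (U l)\<^sup>2) = (\<Sum>l\<in>A. (U l)\<^sup>2)"
    unfolding A_def by (simp add: sum.If_cases Int_def)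
  show ?thesis
  proof (cases "A = {}")
    case True
    then show ?thesis unfolding eq by simp
  next
    case False
    have fin: "finite A" by (simp add: A_def)
    have "(\<Sum>l\<in>A. (U l)\<^sup>2) \<le> (\<Sum>l\<le>Max A. (U l)\<^sup>2)"
      using fin by (intro sum_mono2) auto
    moreover have "Max A \<in> A" using fin False by (rule Max_in)
    ultimately show ?thesis unfolding eq by (simp add: A_def)
  qed
qed

text \<open>The combination \<open>b\<close> is replaced in two steps: coordinates are dropped while
  not yet relevant, at squared cost at most 1 along the path, and \<open>q * b\<close> is rounded to
  integers. A wrong guess outside \<open>B\<close> forces an error of at least
  \<open>1 / 64\<close>, which \<open>small\<close> permits at no more than \<open>L / 8\<close>
  levels; \<open>B\<close> has at most another \<open>L / 8\<close>. Only labels on \<open>R\<close>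
  matter, so \<open>f\<close> is free elsewhere.\<close>

lemma path_labelling:
  fixes u :: "'k \<Rightarrow> nat \<Rightarrow> nat \<Rightarrow> real" and E :: real
  assumes "finite K" "0 < q" and b: "(\<Sum>k\<in>K. \<bar>b k\<bar>) \<le> 1"
    and E: "(\<Sum>k\<in>K. \<Sum>l<L. (u k l (x div 2 ^ (L - l)))\<^sup>2) \<le> E"
    and bad: "8 * card B \<le> L" "finite B"
    and ge: "\<And>l. l < L \<Longrightarrow> l \<notin> B \<Longrightarrow> 1 / 64 \<le> (if odd (x div 2 ^ (L - 1 - l)) then 1 else - 1)
      * (\<Sum>k\<in>K. b k * u k l (x div 2 ^ (L - l)))"
    and small: "4096 * (2 + (E + 1) / (real q)\<^sup>2) \<le> L / 8"
  obtains R n where "R \<subseteq> K" "card R \<le> E" "(\<Sum>k\<in>R. \<bar>n k\<bar>) \<le> int (2 * q)"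
    "\<And>f. (\<And>k. k \<in> R \<Longrightarrow> f k = n k) \<Longrightarrow> 4 * card (mistakes (predictor u K f) L x) \<le> L"
proof -
  define U where "U k l = u k l (x div 2 ^ (L - l))" for k l
  define rel where "rel k l \<longleftrightarrow> relevant u k l (x div 2 ^ (L - l))" for k l
  define v where "v k l = (if rel k l then U k l else 0)" for k l
  define R where "R = {k \<in> K. 1 \<le> (\<Sum>l<L. (U k l)\<^sup>2)}"
  have RK: "R \<subseteq> K" "finite R" using assms(1) by (auto simp: R_def)
  have rel: "rel k l \<longleftrightarrow> 1 \<le> (\<Sum>i\<le>l. (U k i)\<^sup>2)" if "l < L" for k l
    using relevant_path[of l L u k x] that by (simp add: rel_def U_def)
  have rel_R: "k \<in> R" if "rel k l" "l < L" "k \<in> K" for k l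
  proof -
    have "(\<Sum>i\<le>l. (U k i)\<^sup>2) \<le> (\<Sum>i<L. (U k i)\<^sup>2)"
      using that(2) by (intro sum_mono2) auto
    then show ?thesis using that rel[OF that(2)] by (simp add: R_def)
  qed
  have to_R: "(\<Sum>k\<in>K. c k * v k l) = (\<Sum>k\<in>R. c k * v k l)" if "l < L" for c :: "'k \<Rightarrow> real" and l
    using rel_R[OF _ that] RK assms(1) by (intro sum.mono_neutral_right) (auto simp: v_def)
  have "real (card R) \<le> (\<Sum>k\<in>R. \<Sum>l<L. (U k l)\<^sup>2)"
    using sum_bounded_below[of R 1 "\<lambda>k. \<Sum>l<L. (U k l)\<^sup>2"] by (simp add: R_def)
  also have RE: "\<dots> \<le> E"
    using E sum_mono2[OF assms(1) RK(1), of "\<lambda>k. \<Sum>l<L. (U k l)\<^sup>2"] by (simp add: U_def sum_nonneg)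
  finally have card_R: "real (card R) \<le> E" .
  then have E0: "0 \<le> E" by linarith
  \<comment> \<open>With this \<open>\<mu>\<close> each term on the right of the rounding bound is
    at most \<open>\<mu> * q\<close>, so the squared error and the label penalty are both at most
    \<open>2 * \<mu> * q\<close>. Using \<open>E + 1\<close> makes \<open>\<mu>\<close> positive
    even when \<open>E = 0\<close>.\<close>
  define \<mu> where "\<mu> = (E + 1) / (4 * q)"
  have \<mu>: "0 < \<mu>" "\<mu> * q = (E + 1) / 4" using E0 assms(2) by (simp_all add: \<mu>_def)
  obtain n :: "'k \<Rightarrow> int" where
    n: "(\<Sum>l<L. (\<Sum>k\<in>R. (q * b k - n k) * v k l)\<^sup>2) + \<mu> * (\<Sum>k\<in>R. \<bar>real_of_int (n k)\<bar>)
      \<le> (\<Sum>k\<in>R. \<Sum>l<L. (v k l)\<^sup>2) / 4 + \<mu> * (\<Sum>k\<in>R. \<bar>q * b k\<bar>)"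
    using randomized_rounding[OF RK(2), where \<mu> = \<mu> and I = "{..<L}" and c = "\<lambda>k. q * b k" and v = v] \<mu>(1) by auto
  have "(\<Sum>k\<in>R. \<Sum>l<L. (v k l)\<^sup>2) \<le> (\<Sum>k\<in>R. \<Sum>l<L. (U k l)\<^sup>2)"
    by (intro sum_mono) (simp add: v_def)
  with RE have vE: "(\<Sum>k\<in>R. \<Sum>l<L. (v k l)\<^sup>2) \<le> E" by simp
  have "(\<Sum>k\<in>R. \<bar>q * b k\<bar>) = q * (\<Sum>k\<in>R. \<bar>b k\<bar>)"
    by (simp add: abs_mult sum_distrib_left)
  also have "\<dots> \<le> real q * 1"
    using b sum_mono2[OF assms(1) RK(1), of "\<lambda>k. \<bar>b k\<bar>"] by (intro mult_left_mono) auto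
  finally have "\<mu> * (\<Sum>k\<in>R. \<bar>q * b k\<bar>) \<le> \<mu> * q"
    using \<mu>(1) by (intro mult_left_mono) auto
  then have "(\<Sum>k\<in>R. \<Sum>l<L. (v k l)\<^sup>2) / 4 + \<mu> * (\<Sum>k\<in>R. \<bar>q * b k\<bar>) \<le> \<mu> * q + \<mu> * q"
    using vE unfolding \<mu>(2) by (intro add_mono) auto
  with n have total: "(\<Sum>l<L. (\<Sum>k\<in>R. (q * b k - n k) * v k l)\<^sup>2) + \<mu> * (\<Sum>k\<in>R. \<bar>real_of_int (n k)\<bar>)
      \<le> 2 * (\<mu> * q)" unfolding mult_2 by (rule order_trans)
  have "\<mu> * (\<Sum>k\<in>R. \<bar>real_of_int (n k)\<bar>) \<le> \<mu> * (2 * q)"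
    using total sum_nonneg[of "{..<L}" "\<lambda>l. (\<Sum>k\<in>R. (q * b k - n k) * v k l)\<^sup>2"] by simp
  then have "(\<Sum>k\<in>R. \<bar>real_of_int (n k)\<bar>) \<le> real (2 * q)" using \<mu>(1) by simp
  then have "real_of_int (\<Sum>k\<in>R. \<bar>n k\<bar>) \<le> real_of_int (int (2 * q))" by simp
  then have sum_n: "(\<Sum>k\<in>R. \<bar>n k\<bar>) \<le> int (2 * q)" by (simp only: of_int_le_iff)
  \<comment> \<open>\<open>e1\<close> is the truncation error, and \<open>e2\<close> the rounding
    error magnified by \<open>q\<close>.\<close>
  define e1 where "e1 l = (\<Sum>k\<in>K. b k * (U k l - v k l))" for l
  define e2 where "e2 l = (\<Sum>k\<in>R. (q * b k - n k) * v k l)" for l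
  have e2: "(\<Sum>l<L. (e2 l)\<^sup>2) \<le> (E + 1) / 2"
  proof -
    have "0 \<le> \<mu> * (\<Sum>k\<in>R. \<bar>real_of_int (n k)\<bar>)"
      using \<mu>(1) by (intro mult_nonneg_nonneg sum_nonneg) auto
    then have "(\<Sum>l<L. (e2 l)\<^sup>2) \<le> 2 * (\<mu> * q)" using total unfolding e2_def by linarith
    then show ?thesis unfolding \<mu>(2) by simp
  qed
  have "(\<Sum>l<L. (e1 l)\<^sup>2) \<le> (\<Sum>l<L. \<Sum>k\<in>K. \<bar>b k\<bar> * (U k l - v k l)\<^sup>2)"
    unfolding e1_def by (intro sum_mono sum_weighted_square_le b)
  also have "\<dots> = (\<Sum>k\<in>K. \<bar>b k\<bar> * (\<Sum>l<L. (U k l - v k l)\<^sup>2))"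
    by (subst sum.swap) (simp add: sum_distrib_left)
  also have "\<dots> \<le> (\<Sum>k\<in>K. \<bar>b k\<bar> * 1)"
  proof (intro sum_mono mult_left_mono)
    fix k
    have "(\<Sum>l<L. (U k l - v k l)\<^sup>2) = (\<Sum>l<L. if 1 \<le> (\<Sum>i\<le>l. (U k i)\<^sup>2) then 0 else (U k l)\<^sup>2)"
      using rel by (intro sum.cong) (auto simp: v_def)
    then show "(\<Sum>l<L. (U k l - v k l)\<^sup>2) \<le> 1" using sum_before_threshold_le by simp
  qed auto
  finally have e1: "(\<Sum>l<L. (e1 l)\<^sup>2) \<le> 1" using b by simp
  show thesis
  proof (rule that[OF RK(1) card_R sum_n])
    fix f :: "'k \<Rightarrow> int" assume f: "\<And>k. k \<in> R \<Longrightarrow> f k = n k"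
    let ?M = "mistakes (predictor u K f) L x - B"
    have mistake: "1 / 4096 \<le> 2 * (e1 l)\<^sup>2 + 2 / (real q)\<^sup>2 * (e2 l)\<^sup>2" if l: "l \<in> ?M" for l
    proof -
      have lL: "l < L" using l by (simp add: mistakes_def)
      define s :: real where "s = (if odd (x div 2 ^ (L - 1 - l)) then 1 else - 1)"
      define p where "p = (\<Sum>k\<in>R. n k * v k l)"
      have "(\<Sum>k\<in>K. if relevant u k l (x div 2 ^ (L - l)) then f k * u k l (x div 2 ^ (L - l)) else 0)
          = (\<Sum>k\<in>K. f k * v k l)"
        by (intro sum.cong) (auto simp: v_def rel_def U_def)
      also have "\<dots> = p"
        unfolding to_R[OF lL] p_def using f by simp
      finally have "predictor u K f l (x div 2 ^ (L - l)) \<longleftrightarrow> 0 < p" by (simp add: predictor_def)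
      \<comment> \<open>A wrong guess puts \<open>p\<close> on the wrong side of zero; a tie
        \<open>p = 0\<close> yields the guess \<open>False\<close>, and then
        \<open>s * p \<le> 0\<close> holds as well.\<close>
      then have sp: "s * p \<le> 0" using l by (auto simp: mistakes_def s_def)
      have "(\<Sum>k\<in>K. b k * U k l) = e1 l + (\<Sum>k\<in>R. b k * v k l)"
        by (simp add: e1_def right_diff_distrib sum_subtractf to_R[OF lL])
      also have "(\<Sum>k\<in>R. b k * v k l) = (p + e2 l) / q"
        using assms(2) by (simp add: p_def e2_def left_diff_distrib sum_subtractf sum_divide_distrib)
      finally have "1 / 64 \<le> s * (e1 l + (p + e2 l) / q)"
        using ge[OF lL] l unfolding s_def U_def by simp
      also have "\<dots> = s * p / q + s * (e1 l + e2 l / q)" by (simp add: algebra_simps add_divide_distrib)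
      also have "\<dots> \<le> s * (e1 l + e2 l / q)" using sp by (simp add: divide_nonpos_nonneg)
      finally have "(1 / 64)\<^sup>2 \<le> (s * (e1 l + e2 l / q))\<^sup>2" by (intro power_mono) auto
      also have "\<dots> = (e1 l + e2 l / q)\<^sup>2" by (simp add: s_def power_mult_distrib)
      also have "\<dots> \<le> 2 * (e1 l)\<^sup>2 + 2 * (e2 l / q)\<^sup>2"
        using sum_squares_bound[of "e1 l" "e2 l / q"] unfolding power2_sum by linarith
      finally show ?thesis by (simp add: power_divide power2_eq_square)
    qed
    have "real (card ?M) * (1 / 4096) = (\<Sum>l\<in>?M. 1 / 4096)" by simp
    also have "\<dots> \<le> (\<Sum>l\<in>?M. 2 * (e1 l)\<^sup>2 + 2 / (real q)\<^sup>2 * (e2 l)\<^sup>2)"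
      using mistake by (rule sum_mono)
    also have "\<dots> \<le> (\<Sum>l<L. 2 * (e1 l)\<^sup>2 + 2 / (real q)\<^sup>2 * (e2 l)\<^sup>2)"
      by (intro sum_mono2) (auto simp: mistakes_def)
    also have "\<dots> = 2 * (\<Sum>l<L. (e1 l)\<^sup>2) + 2 / (real q)\<^sup>2 * (\<Sum>l<L. (e2 l)\<^sup>2)"
      by (simp add: sum.distrib sum_distrib_left)
    also have "\<dots> \<le> 2 * 1 + 2 / (real q)\<^sup>2 * ((E + 1) / 2)"
      using e1 e2 by (intro add_mono mult_left_mono) auto
    also have "\<dots> = 2 + (E + 1) / (real q)\<^sup>2" by (simp add: add_divide_distrib)
    finally have "4096 * (real (card ?M) * (1 / 4096)) \<le> 4096 * (2 + (E + 1) / (real q)\<^sup>2)"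
      by (rule mult_left_mono) simp
    from order_trans[OF this small] have "real (card ?M) \<le> L / 8" by simp
    moreover have "card (mistakes (predictor u K f) L x) \<le> card ?M + card B"
      using card_Un_le[of ?M B] bad(2)
      by (metis Un_Diff_cancel2 card_mono finite_UnI finite_mistakes order_trans sup_ge1)
    ultimately show "4 * card (mistakes (predictor u K f) L x) \<le> L" using bad(1) by linarith
  qed
qed

section \<open>Counting the paths that have a labelling\<close>

text \<open>The labels of a path are nonzero at no more than \<open>2 * q\<close> of its at most
  \<open>N\<close> coordinates, so under the product weight \<open>w\<close> they have mass at least
  \<open>1 / 2 * \<delta> ^ (2 * q)\<close>. Double counting plays this against the few paths on
  which one labelling predicts well.\<close>

lemma card_paths_le:
  fixes u :: "'k \<Rightarrow> nat \<Rightarrow> nat \<Rightarrow> real"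
  assumes "finite K" "0 < q" "0 < N" and X: "X \<subseteq> {..<2 ^ L}"
    and lab: "\<And>x. x \<in> X \<Longrightarrow> \<exists>R n. R \<subseteq> K \<and> card R \<le> N \<and> (\<Sum>k\<in>R. \<bar>n k\<bar>) \<le> int (2 * q) \<and>
      (\<forall>f. (\<forall>k\<in>R. f k = n k) \<longrightarrow> 4 * card (mistakes (predictor u K f) L x) \<le> L)"
  shows "real (card X) * (1 / 2 * (1 / (8 * real q * real N)) ^ (2 * q)) \<le> (3 / 2) ^ L * 2 powr (L / 4)"
proof -
  obtain R n where R: "\<And>x. x \<in> X \<Longrightarrow> R x \<subseteq> K" "\<And>x. x \<in> X \<Longrightarrow> card (R x) \<le> N"
    and n: "\<And>x. x \<in> X \<Longrightarrow> (\<Sum>k\<in>R x. \<bar>n x k\<bar>) \<le> int (2 * q)"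
    and good: "\<And>x f. x \<in> X \<Longrightarrow> (\<And>k. k \<in> R x \<Longrightarrow> f k = n x k) \<Longrightarrow>
      4 * card (mistakes (predictor u K f) L x) \<le> L"
  proof -
    define \<Phi> where "\<Phi> x R n \<longleftrightarrow> R \<subseteq> K \<and> card R \<le> N \<and> (\<Sum>k\<in>R. \<bar>n k\<bar>) \<le> int (2 * q) \<and>
      (\<forall>f. (\<forall>k\<in>R. f k = n k) \<longrightarrow> 4 * card (mistakes (predictor u K f) L x) \<le> L)" for x R n
    have "\<forall>x\<in>X. \<exists>R n. \<Phi> x R n" using lab by (simp only: \<Phi>_def) blast
    from bchoice[OF this] obtain R where "\<forall>x\<in>X. \<exists>n. \<Phi> x (R x) n" by blast
    from bchoice[OF this] obtain n where "\<forall>x\<in>X. \<Phi> x (R x) (n x)" by blast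
    then show thesis by (intro that[of R n]) (simp_all add: \<Phi>_def)
  qed
  define I where "I = {- int (2 * q)..int (2 * q)}"
  \<comment> \<open>The \<open>4 * q\<close> nonzero labels together receive mass
    \<open>1 / (2 * N)\<close>, so by Bernoulli's inequality \<open>N\<close> zero labels still have
    product mass at least one half.\<close>
  define \<delta> where "\<delta> = 1 / (8 * real q * real N)"
  define w where "w i = (if i = 0 then 1 - 1 / (2 * real N) else \<delta>)" for i :: int
  have \<delta>: "0 < \<delta>" "\<delta> \<le> 1" "4 * q * \<delta> = 1 / (2 * real N)"
  proof -
    have "1 \<le> real q * real N" using assms(2,3) by (simp add: Suc_leI flip: of_nat_mult)
    then show "0 < \<delta>" "\<delta> \<le> 1" using assms(2,3) by (simp_all add: \<delta>_def)
    show "4 * q * \<delta> = 1 / (2 * real N)" using assms(2) by (simp add: \<delta>_def)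
  qed
  have half: "1 / (2 * real N) \<le> 1 / 2" using assms(3) by simp
  have I: "card (I - {0}) = 4 * q" "0 \<in> I" "finite I" by (simp_all add: I_def)
  have "real (card X) * (1 / 2 * \<delta> ^ (2 * q)) \<le> (3 / 2) ^ L * 2 powr (L / 4)"
  proof (rule product_weight_double_counting[where K = K and I = I and w = w and S = R and n = n
      and P = "\<lambda>f x. 4 * card (mistakes (predictor u K f) L x) \<le> L"])
    show "finite X" using X finite_subset by blast
    show "0 \<le> w i" for i using \<delta>(1) half by (simp add: w_def)
    have "sum w I = w 0 + sum w (I - {0})" using I by (simp add: sum.remove)
    also have "sum w (I - {0}) = (\<Sum>i\<in>I - {0}. \<delta>)" by (intro sum.cong) (auto simp: w_def)
    finally show "sum w I = 1" using \<delta>(3) I(1) by (simp add: w_def)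
    show "n x k \<in> I" if "x \<in> X" "k \<in> R x" for x k
    proof -
      have "finite (R x)" using R(1)[OF that(1)] assms(1) finite_subset by blast
      then have "\<bar>n x k\<bar> \<le> (\<Sum>k\<in>R x. \<bar>n x k\<bar>)" using that(2) by (intro member_le_sum) auto
      with n[OF that(1)] show ?thesis by (auto simp: I_def)
    qed
    show "1 / 2 * \<delta> ^ (2 * q) \<le> (\<Prod>k\<in>R x. w (n x k))" if x: "x \<in> X" for x
    proof -
      have fin: "finite (R x)" using R(1)[OF x] assms(1) finite_subset by blast
      let ?Z = "{k \<in> R x. n x k = 0}" and ?Y = "{k \<in> R x. n x k \<noteq> 0}"
      have "int (card ?Y) = (\<Sum>k\<in>?Y. 1)" by simp
      also have "\<dots> \<le> (\<Sum>k\<in>?Y. \<bar>n x k\<bar>)" by (intro sum_mono) auto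
      also have "\<dots> \<le> (\<Sum>k\<in>R x. \<bar>n x k\<bar>)" using fin by (intro sum_mono2) auto
      finally have "card ?Y \<le> 2 * q" using n[OF x] by linarith
      then have Y: "\<delta> ^ (2 * q) \<le> \<delta> ^ card ?Y" using \<delta> by (intro power_decreasing) auto
      have "card ?Z \<le> N"
        using card_mono[OF fin, of ?Z] R(2)[OF x] by auto
      then have "(1 - 1 / (2 * real N)) ^ N \<le> (1 - 1 / (2 * real N)) ^ card ?Z"
        using half by (intro power_decreasing) auto
      moreover have "1 / 2 \<le> (1 - 1 / (2 * real N)) ^ N"
        using Bernoulli_inequality[of "- (1 / (2 * real N))" N] half assms(3) by simp
      ultimately have "1 / 2 \<le> (1 - 1 / (2 * real N)) ^ card ?Z" by linarith
      then have "1 / 2 * \<delta> ^ (2 * q) \<le> (1 - 1 / (2 * real N)) ^ card ?Z * \<delta> ^ card ?Y"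
        using Y \<delta>(1) half by (intro mult_mono) auto
      also have "\<dots> = (\<Prod>k\<in>R x. w (n x k))"
        using fin by (simp add: w_def prod.If_cases Int_def)
      finally show ?thesis .
    qed
    show "real (card {x \<in> X. 4 * card (mistakes (predictor u K f) L x) \<le> L}) \<le> (3 / 2) ^ L * 2 powr (L / 4)" for f
    proof -
      have "card {x \<in> X. 4 * card (mistakes (predictor u K f) L x) \<le> L}
          \<le> card {x. x < 2 ^ L \<and> 4 * card (mistakes (predictor u K f) L x) \<le> L}"
        using X by (intro card_mono) auto
      then show ?thesis using card_few_mistakes[of L "predictor u K f"] by linarith
    qed
  qed (use assms(1) I R(1) good in auto)
  then show ?thesis by (simp add: \<delta>_def)
qed

section \<open>The lower bound\<close>

lemma eventually_parameter_bounds: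
  "eventually (\<lambda>L::nat. 1 \<le> ln (real L) \<and> 1 \<le> real L / (400 * ln (real L))
    \<and> 4096 * (2 + (16 * (real L ^ 3 / (10 ^ 12 * ln (real L) ^ 2)) + 1) * (400 * ln (real L) / real L) ^ 2) \<le> real L / 8
    \<and> 8 * (81 / 8) powr (real L / 4) < 13 powr (real L / 4)) sequentially"
  by (intro eventually_conj; real_asymp)

text \<open>With \<open>N = L ^ 3\<close> the factor \<open>8 * q * N\<close> is at most
  \<open>L ^ 4\<close>, so the \<open>2 * q\<close> nonzero labels cost a factor of at most
  \<open>exp (L / 25)\<close>, less than the exponential gap between \<open>2 ^ L\<close> and the
  number of paths that one strategy predicts well.\<close>

lemma eventually_parameters:
  fixes G :: "nat \<Rightarrow> real" and q :: "nat \<Rightarrow> nat"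
  defines "G \<equiv> \<lambda>L. real L ^ 3 / (10 ^ 12 * ln (real L) ^ 2)"
    and "q \<equiv> \<lambda>L. nat \<lfloor>real L / (200 * ln (real L))\<rfloor>"
  shows "eventually (\<lambda>L. 0 < L \<and> 0 < G L \<and> 0 < q L \<and> 16 * G L \<le> real (L ^ 3)
    \<and> 4096 * (2 + (16 * G L + 1) / (real (q L))\<^sup>2) \<le> real L / 8
    \<and> (3 / 2) ^ L * 2 powr (real L / 4) < 2 ^ L / 4 * (1 / 2 * (1 / (8 * real (q L) * real (L ^ 3))) ^ (2 * q L))) sequentially"
  using eventually_parameter_bounds
proof eventually_elim
  case (elim L)
  \<comment> \<open>\<open>q L\<close> is the floor of \<open>2 * y\<close>, so it lies between
    \<open>y\<close> and \<open>2 * y\<close> and the floor can be forgotten.\<close>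
  define y where "y = real L / (400 * ln (real L))"
  have ln: "1 \<le> ln (real L)" and y: "1 \<le> y" using elim by (simp_all add: y_def)
  have L: "0 < L" using ln by (cases "L = 0") auto
  have G: "0 < G L" using L ln unfolding G_def by (intro divide_pos_pos mult_pos_pos) auto
  have q_eq: "q L = nat \<lfloor>2 * y\<rfloor>" by (simp add: q_def y_def)
  have q: "y \<le> q L" "real (q L) \<le> 2 * y" using y unfolding q_eq by linarith+
  have q0: "0 < q L" using q(1) y by (metis gr0I not_one_le_zero of_nat_0 order_trans)
  have "16 * G L \<le> real (L ^ 3)"
  proof -
    have "real L ^ 3 * 16 \<le> real L ^ 3 * (10 ^ 12 * ln (real L) ^ 2)"
      using one_le_power[OF ln, of 2] by (intro mult_left_mono) auto
    then show ?thesis using ln by (simp add: G_def pos_divide_le_eq)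
  qed
  moreover have "4096 * (2 + (16 * G L + 1) / (real (q L))\<^sup>2) \<le> real L / 8"
  proof -
    have "(16 * G L + 1) / (real (q L))\<^sup>2 \<le> (16 * G L + 1) / y\<^sup>2"
      using G q(1) y by (intro divide_left_mono power_mono mult_pos_pos) auto
    also have "\<dots> = (16 * G L + 1) * (400 * ln (real L) / real L) ^ 2"
    proof -
      have inv: "400 * ln (real L) / real L = 1 / y" by (simp add: y_def)
      show ?thesis unfolding inv by (simp add: power_one_over)
    qed
    finally have "4096 * (2 + (16 * G L + 1) / (real (q L))\<^sup>2)
        \<le> 4096 * (2 + (16 * G L + 1) * (400 * ln (real L) / real L) ^ 2)"
      by (intro mult_left_mono add_left_mono) auto
    also have "\<dots> \<le> real L / 8" using elim by (simp only: G_def)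
    finally show ?thesis .
  qed
  moreover have "(3 / 2) ^ L * 2 powr (real L / 4) < 2 ^ L / 4 * (1 / 2 * (1 / (8 * real (q L) * real (L ^ 3))) ^ (2 * q L))"
  proof -
    have "2 * y * 200 \<le> 2 * y * 200 * ln (real L)" using ln y by simp
    also have "\<dots> = real L" using ln by (simp add: y_def)
    finally have "8 * real (q L) \<le> real L" using q(2) y by linarith
    then have "8 * real (q L) * real (L ^ 3) \<le> real L * real L ^ 3" by (simp add: mult_right_mono)
    also have "\<dots> = real L ^ 4" by (simp add: eval_nat_numeral)
    also have "\<dots> = exp (4 * ln (real L))"
      using L exp_of_nat_mult[of 4 "ln (real L)"] by simp
    finally have "exp (- (4 * ln (real L))) \<le> 1 / (8 * real (q L) * real (L ^ 3))"
      using L q0 by (simp add: exp_minus field_simps)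
    then have "exp (- (4 * ln (real L))) ^ (2 * q L) \<le> (1 / (8 * real (q L) * real (L ^ 3))) ^ (2 * q L)"
      by (intro power_mono) auto
    moreover have "exp (- (real L / 25)) \<le> exp (- (4 * ln (real L))) ^ (2 * q L)"
    proof -
      have "real (2 * q L) * (4 * ln (real L)) \<le> 2 * (2 * y) * (4 * ln (real L))"
        using q(2) ln by (intro mult_right_mono) auto
      also have "\<dots> = real L / 25" using ln by (simp add: y_def)
      finally show ?thesis by (simp flip: exp_of_nat_mult)
    qed
    ultimately have main: "exp (- (real L / 25)) \<le> (1 / (8 * real (q L) * real (L ^ 3))) ^ (2 * q L)" by linarith
    \<comment> \<open>Passing to fourth powers makes the bases comparable:
      \<open>(3 / 2) ^ 4 * 2 = 81 / 8\<close>, while \<open>16 * exp (- (4 / 25))\<close> is at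
      least 13.\<close>
    have pow: "c ^ L = (c ^ 4) powr (real L / 4)" if "0 < c" for c :: real
    proof -
      have "c ^ L = c powr (real L)" using that by (simp add: powr_realpow)
      also have "\<dots> = (c powr 4) powr (real L / 4)" by (simp add: powr_powr)
      finally show ?thesis using that powr_realpow[of c 4] by simp
    qed
    have "(13::real) \<le> 16 * exp (- (4 / 25))"
      using exp_ge_add_one_self[of "- (4 / 25) :: real"] by simp
    then have "13 powr (real L / 4) \<le> (16 * exp (- (4 / 25))) powr (real L / 4)"
      by (intro powr_mono2) auto
    also have "\<dots> = 16 powr (real L / 4) * exp (- (4 / 25)) powr (real L / 4)"
      by (simp add: powr_mult)
    also have "exp (- (4 / 25)) powr (real L / 4) = exp (- (real L / 25))"
      by (simp add: powr_def)
    also have "16 powr (real L / 4) = 2 ^ L" using pow[of 2] by simp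
    finally have "13 powr (real L / 4) \<le> 2 ^ L * exp (- (real L / 25))" .
    moreover have "(3 / 2) ^ L * 2 powr (real L / 4) = (81 / 8) powr (real L / 4)"
      using pow[of "3 / 2"] by (simp add: power_divide flip: powr_mult)
    ultimately have "8 * ((3 / 2) ^ L * 2 powr (real L / 4)) < 2 ^ L * exp (- (real L / 25))"
      using elim by simp
    also have "\<dots> \<le> 2 ^ L * (1 / (8 * real (q L) * real (L ^ 3))) ^ (2 * q L)"
      using main by (intro mult_left_mono) auto
    finally show ?thesis by simp
  qed
  ultimately show ?case using L G q0 by blast
qed

lemma card_markov:
  fixes h :: "'x \<Rightarrow> real"
  assumes "finite S" "\<And>x. x \<in> S \<Longrightarrow> 0 \<le> h x" "sum h S \<le> c * t" "0 < t"
  shows "real (card {x \<in> S. t < h x}) \<le> c"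
proof -
  have "real (card {x \<in> S. t < h x}) * t = (\<Sum>x\<in>{x \<in> S. t < h x}. t)" by simp
  also have "\<dots> \<le> (\<Sum>x\<in>{x \<in> S. t < h x}. h x)" by (intro sum_mono) auto
  also have "\<dots> \<le> sum h S" using assms(1,2) by (intro sum_mono2) auto
  also note assms(3)
  finally show ?thesis using assms(4) by simp
qed

section \<open>From factorizations to the norm\<close>

text \<open>The \<open>b k x\<close> expand the odd column \<open>2 * x + 1\<close> in the vectors
  \<open>a k\<close>. The path energy averages at most \<open>4 * G\<close> and the number of bad
  levels at most \<open>L / 16\<close>, so by Markov's inequality at least a quarter of all
  \<open>x\<close> admits \<open>path_labelling\<close>, and counting these paths gives the
  bound.\<close>

lemma factorization_bound:
  fixes a :: "nat \<Rightarrow> nat \<Rightarrow> real" and b :: "nat \<Rightarrow> nat \<Rightarrow> real" and G :: real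
  assumes "0 < G" "0 < q" "0 < N" "0 < L" "16 * G \<le> real N"
    and small: "4096 * (2 + (16 * G + 1) / (real q)\<^sup>2) \<le> L / 8"
    and rows: "\<And>i. i < 2 ^ (L + 1) \<Longrightarrow> (\<Sum>k<m. (a k i)\<^sup>2) \<le> G"
    and cols: "\<And>x. x < 2 ^ L \<Longrightarrow> (\<Sum>k<m. \<bar>b k x\<bar>) \<le> 1"
    and factor: "\<And>i x. i < 2 ^ (L + 1) \<Longrightarrow> x < 2 ^ L \<Longrightarrow>
      (\<Sum>k<m. b k x * a k i) = (if 2 * x + 1 \<le> i then 1 else 0)"
  shows "2 ^ L / 4 * (1 / 2 * (1 / (8 * real q * real N)) ^ (2 * q)) \<le> (3 / 2) ^ L * 2 powr (L / 4)"
proof -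
  define u where "u k l y = wavelet (a k) (2 ^ (L - 1 - l)) y" for k l y
  define h where "h x = (\<Sum>k<m. \<Sum>l<L. (u k l (x div 2 ^ (L - l)))\<^sup>2)" for x
  define B where "B x = {l. l < L \<and> x mod 2 ^ (L - 1 - l)
      \<notin> {2 ^ (L - 1 - l) div 32..<2 ^ (L - 1 - l) - 2 ^ (L - 1 - l) div 32}}" for x :: nat
  define X where "X = {x. x < 2 ^ L \<and> h x \<le> 16 * G \<and> 8 * card (B x) \<le> L}"
  have h_nonneg: "0 \<le> h x" for x by (simp add: h_def sum_nonneg)
  have "(\<Sum>x<2 ^ L. h x) = (\<Sum>k<m. \<Sum>x<2 ^ L. \<Sum>l<L. (u k l (x div 2 ^ (L - l)))\<^sup>2)"
    unfolding h_def by (rule sum.swap)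
  also have "\<dots> \<le> (\<Sum>k<m. 2 * (\<Sum>i<2 ^ (L + 1). (a k i)\<^sup>2))"
    unfolding u_def by (intro sum_mono wavelet_energy)
  also have "\<dots> = 2 * (\<Sum>i<2 ^ (L + 1). \<Sum>k<m. (a k i)\<^sup>2)"
    by (subst sum.swap) (simp add: sum_distrib_left)
  also have "\<dots> \<le> 2 * (\<Sum>i<(2::nat) ^ (L + 1). G)"
    by (intro mult_left_mono sum_mono rows) auto
  also have "\<dots> = 2 ^ L / 4 * (16 * G)" by simp
  finally have sum_h: "(\<Sum>x<2 ^ L. h x) \<le> 2 ^ L / 4 * (16 * G)" .
  define Y where "Y = {x \<in> {..<2 ^ L}. 16 * G < h x}"
  define Z where "Z = {x \<in> {..<2 ^ L}. L / 8 < real (card (B x))}"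
  have Y: "real (card Y) \<le> 2 ^ L / 4"
    unfolding Y_def using assms(1) sum_h by (intro card_markov) (auto simp: h_nonneg)
  have "(\<Sum>x<2 ^ L. real (card (B x))) \<le> real L * 2 ^ L / 16"
    unfolding B_def by (rule sum_card_extreme_levels)
  also have "\<dots> = 2 ^ L / 2 * (L / 8)" by simp
  finally have "(\<Sum>x<2 ^ L. real (card (B x))) \<le> 2 ^ L / 2 * (L / 8)" .
  then have Z: "real (card Z) \<le> 2 ^ L / 2"
    unfolding Z_def using assms(4) by (intro card_markov) auto
  have sub: "{..<2 ^ L} \<subseteq> X \<union> Y \<union> Z" by (auto simp: X_def Y_def Z_def)
  have fin: "finite (X \<union> Y \<union> Z)" by (simp add: X_def Y_def Z_def)
  have "2 ^ L = card {..<(2::nat) ^ L}" by simp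
  also have "\<dots> \<le> card (X \<union> Y \<union> Z)" using fin sub by (rule card_mono)
  also have "\<dots> \<le> card X + card Y + card Z"
    using card_Un_le[of "X \<union> Y" Z] card_Un_le[of X Y] by linarith
  finally have "real (2 ^ L) \<le> real (card X + card Y + card Z)" by (rule of_nat_mono)
  then have X: "2 ^ L / 4 \<le> real (card X)" using Y Z by simp
  have "real (card X) * (1 / 2 * (1 / (8 * real q * real N)) ^ (2 * q)) \<le> (3 / 2) ^ L * 2 powr (L / 4)"
  proof (rule card_paths_le[where K = "{..<m}" and u = u])
    fix x assume x: "x \<in> X"
    then have xL: "x < 2 ^ L" by (simp add: X_def)
    have ge: "1 / 64 \<le> (if odd (x div 2 ^ (L - 1 - l)) then 1 else - 1)
        * (\<Sum>k<m. b k x * u k l (x div 2 ^ (L - l)))" if l: "l < L" "l \<notin> B x" for l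
    proof -
      let ?r = "(2::nat) ^ (L - 1 - l)"
      have r: "2 ^ (L - l) = 2 * ?r" using l(1) by (simp flip: power_Suc add: Suc_diff_Suc)
      \<comment> \<open>The wavelet at this node reads only rows below \<open>2 ^ (L + 1)\<close>,
        where \<open>factor\<close> applies.\<close>
      have "x div (2 * ?r) < 2 ^ l"
        using xL l(1) unfolding r[symmetric] by (simp add: div_less_iff_less_mult flip: power_add)
      then have "(x div (2 * ?r) + 1) * (2 * ?r) \<le> 2 ^ l * (2 * ?r)" by (intro mult_right_mono) auto
      also have "\<dots> = 2 ^ L" using l(1) unfolding r[symmetric] by (simp flip: power_add)
      finally have range: "(x div (2 * ?r) + 1) * (4 * ?r) \<le> 2 ^ (L + 1)" by simp
      have "(\<Sum>k<m. b k x * u k l (x div 2 ^ (L - l)))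
          = wavelet (\<lambda>i. \<Sum>k<m. b k x * a k i) ?r (x div (2 * ?r))"
        by (simp only: u_def wavelet_linear r)
      also have "\<dots> = wavelet (\<lambda>i. if 2 * x + 1 \<le> i then 1 else 0) ?r (x div (2 * ?r))"
        using range xL by (intro wavelet_cong factor) (auto intro: less_le_trans)
      finally have eq: "(\<Sum>k<m. b k x * u k l (x div 2 ^ (L - l)))
          = wavelet (\<lambda>i. if 2 * x + 1 \<le> i then 1 else 0) ?r (x div (2 * ?r))" .
      have mem: "x mod ?r \<in> {?r div 32..<?r - ?r div 32}"
        using l unfolding B_def mem_Collect_eq by blast
      show ?thesis unfolding eq by (rule wavelet_step_ge[OF _ mem]) simp
    qed
    from x have hx: "(\<Sum>k<m. \<Sum>l<L. (u k l (x div 2 ^ (L - l)))\<^sup>2) \<le> 16 * G" and Bx: "8 * card (B x) \<le> L"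
      by (simp_all add: X_def h_def)
    have "finite (B x)" by (simp add: B_def)
    from path_labelling[where K = "{..<m}" and u = u and x = x and B = "B x" and b = "\<lambda>k. b k x",
        OF finite_lessThan assms(2) cols[OF xL] hx Bx this ge small]
    obtain R n where Rn: "R \<subseteq> {..<m}" "card R \<le> 16 * G" "(\<Sum>k\<in>R. \<bar>n k\<bar>) \<le> int (2 * q)"
      "\<And>f. (\<And>k. k \<in> R \<Longrightarrow> f k = n k) \<Longrightarrow> 4 * card (mistakes (predictor u {..<m} f) L x) \<le> L"
      by blast
    have "card R \<le> N" using Rn(2) assms(5) by linarith
    then show "\<exists>R n. R \<subseteq> {..<m} \<and> card R \<le> N \<and> (\<Sum>k\<in>R. \<bar>n k\<bar>) \<le> int (2 * q) \<and>
      (\<forall>f. (\<forall>k\<in>R. f k = n k) \<longrightarrow> 4 * card (mistakes (predictor u {..<m} f) L x) \<le> L)"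
      using Rn by (intro exI[of _ R] exI[of _ n] conjI allI impI) simp_all
  qed (use assms(2,3) in \<open>auto simp: X_def\<close>)
  moreover have "2 ^ L / 4 * (1 / 2 * (1 / (8 * real q * real N)) ^ (2 * q)) \<le> real (card X) * (1 / 2 * (1 / (8 * real q * real N)) ^ (2 * q))"
    using X by (intro mult_right_mono) auto
  ultimately show ?thesis by linarith
qed

text \<open>Multiplying \<open>A\<close> and dividing \<open>B\<close> by \<open>\<beta>\<close>
  keeps the product, makes the columns of \<open>\<ell>\<close>1-norm at most 1 and the rows of
  \<open>\<ell>\<close>2-norm at most \<open>\<alpha> * \<beta>\<close>. A value below
  \<open>sqrt G\<close> would then contradict the last assumption. Only the first
  \<open>2 ^ (L + 1)\<close> rows and the odd columns among as many enter.\<close>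

lemma gamma_2_1_lower_triangular_ones_ge:
  fixes G :: real
  assumes U: "2 ^ (L + 1) \<le> U"
    and params: "0 < G" "0 < q" "0 < N" "0 < L" "16 * G \<le> real N"
      "4096 * (2 + (16 * G + 1) / (real q)\<^sup>2) \<le> L / 8"
      "(3 / 2) ^ L * 2 powr (L / 4) < 2 ^ L / 4 * (1 / 2 * (1 / (8 * real q * real N)) ^ (2 * q))"
  shows "sqrt G \<le> gamma_2_1 (lower_triangular_ones U)"
  unfolding gamma_2_1_def
proof (rule cInf_greatest)
  let ?Q = "lower_triangular_ones U"
  have Q: "?Q \<in> carrier_mat U U" by (simp add: lower_triangular_ones_def)
  then have "?Q = ?Q * 1\<^sub>m U" by simp
  with Q have "norm_2_to_inf ?Q * norm_1_to_1 (1\<^sub>m U) \<in> {norm_2_to_inf A * norm_1_to_1 B |A B m.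
      A \<in> carrier_mat (dim_row ?Q) m \<and> B \<in> carrier_mat m (dim_col ?Q) \<and> ?Q = A * B}"
    unfolding mem_Collect_eq
    by (intro exI[of _ ?Q] exI[of _ "1\<^sub>m U"] exI[of _ U]) auto
  then show "{norm_2_to_inf A * norm_1_to_1 B |A B m.
      A \<in> carrier_mat (dim_row ?Q) m \<and> B \<in> carrier_mat m (dim_col ?Q) \<and> ?Q = A * B} \<noteq> {}"
    by blast
  fix g assume "g \<in> {norm_2_to_inf A * norm_1_to_1 B |A B m.
      A \<in> carrier_mat (dim_row ?Q) m \<and> B \<in> carrier_mat m (dim_col ?Q) \<and> ?Q = A * B}"
  then obtain A B m where g: "g = norm_2_to_inf A * norm_1_to_1 B"
    and A: "A \<in> carrier_mat U m" and B: "B \<in> carrier_mat m U" and AB: "?Q = A * B"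
    using Q by auto
  define \<alpha> \<beta> where "\<alpha> = norm_2_to_inf A" and "\<beta> = norm_1_to_1 B"
  have U2: "2 ^ (L + 1) \<le> U" "0 < U" using U by (auto intro: less_le_trans[of 0 "2 ^ (L + 1)"])
  have entry: "(\<Sum>k<m. A $$ (i, k) * B $$ (k, j)) = (if j \<le> i then 1 else 0)" if "i < U" "j < U" for i j
  proof -
    have "(A * B) $$ (i, j) = (\<Sum>k<m. A $$ (i, k) * B $$ (k, j))"
      using A B that by (simp add: scalar_prod_def lessThan_atLeast0)
    then show ?thesis using that by (simp flip: AB add: lower_triangular_ones_def)
  qed
  have row: "L2_set (\<lambda>k. A $$ (i, k)) {..<m} \<le> \<alpha>" if "i < U" for i
    using A that unfolding \<alpha>_def norm_2_to_inf_def by (intro Max_ge) auto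
  have col: "(\<Sum>k<m. \<bar>B $$ (k, j)\<bar>) \<le> \<beta>" if "j < U" for j
    using B that unfolding \<beta>_def norm_1_to_1_def by (intro Max_ge) auto
  have \<alpha>: "0 \<le> \<alpha>" using row[OF U2(2)] L2_set_nonneg order_trans by blast
  have \<beta>: "0 < \<beta>"
  proof (rule ccontr)
    assume "\<not> 0 < \<beta>"
    then have "(\<Sum>k<m. \<bar>B $$ (k, 0)\<bar>) \<le> 0" using col[OF U2(2)] by linarith
    then have "(\<Sum>k<m. \<bar>B $$ (k, 0)\<bar>) = 0" by (intro order.antisym sum_nonneg) auto
    then have "B $$ (k, 0) = 0" if "k < m" for k using that by (simp add: sum_nonneg_eq_0_iff)
    then have "(\<Sum>k<m. A $$ (0, k) * B $$ (k, 0)) = 0" by simp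
    then show False using entry[OF U2(2) U2(2)] by simp
  qed
  show "sqrt G \<le> g"
  proof (rule ccontr)
    assume "\<not> sqrt G \<le> g"
    then have "\<alpha> * \<beta> < sqrt G" by (simp add: g \<alpha>_def \<beta>_def)
    then have "(\<alpha> * \<beta>)\<^sup>2 \<le> (sqrt G)\<^sup>2" using \<alpha> \<beta> by (intro power_mono) auto
    then have g2: "(\<alpha> * \<beta>)\<^sup>2 \<le> G" using params(1) by simp
    have "2 ^ L / 4 * (1 / 2 * (1 / (8 * real q * real N)) ^ (2 * q)) \<le> (3 / 2) ^ L * 2 powr (L / 4)"
    proof (rule factorization_bound[OF params(1-6),
          where a = "\<lambda>k i. \<beta> * A $$ (i, k)" and b = "\<lambda>k x. B $$ (k, 2 * x + 1) / \<beta>" and m = m])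
      fix i :: nat assume "i < 2 ^ (L + 1)"
      then have "L2_set (\<lambda>k. A $$ (i, k)) {..<m} \<le> \<alpha>" using U2 by (intro row) linarith
      then have "(\<Sum>k<m. (A $$ (i, k))\<^sup>2) \<le> \<alpha>\<^sup>2"
        unfolding L2_set_def by (rule sqrt_le_D)
      then have "\<beta>\<^sup>2 * (\<Sum>k<m. (A $$ (i, k))\<^sup>2) \<le> \<beta>\<^sup>2 * \<alpha>\<^sup>2" by (intro mult_left_mono) auto
      then show "(\<Sum>k<m. (\<beta> * A $$ (i, k))\<^sup>2) \<le> G"
        using g2 by (simp add: power_mult_distrib sum_distrib_left mult.commute)
    next
      fix x :: nat assume "x < 2 ^ L"
      then have "2 * x + 1 < U" using U2 by simp
      then have "(\<Sum>k<m. \<bar>B $$ (k, 2 * x + 1)\<bar>) / \<beta> \<le> 1" using col \<beta> by simp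
      then show "(\<Sum>k<m. \<bar>B $$ (k, 2 * x + 1) / \<beta>\<bar>) \<le> 1"
        using \<beta> by (simp add: sum_divide_distrib)
    next
      fix i x :: nat assume "i < 2 ^ (L + 1)" "x < 2 ^ L"
      then have "i < U" "2 * x + 1 < U" using U2 by simp_all
      then show "(\<Sum>k<m. B $$ (k, 2 * x + 1) / \<beta> * (\<beta> * A $$ (i, k))) = (if 2 * x + 1 \<le> i then 1 else 0)"
        using entry[of i "2 * x + 1"] \<beta> by (simp add: mult.commute)
    qed
    then show False using params(7) by linarith
  qed
qed

section \<open>Asymptotics in the size of the matrix\<close>

lemma filterlim_dyadic_depth: "filterlim (\<lambda>U::nat. nat \<lfloor>log 2 (real U)\<rfloor> - 1) at_top sequentially"
  by real_asymp

lemma eventually_ln_bounds: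
  "eventually (\<lambda>U::nat. 4 \<le> real U \<and> 1 \<le> ln (ln (real U)) \<and> 25 * 2 \<le> 11 * ln (real U)
    \<and> ln (2 * ln (real U)) \<le> 2 * ln (ln (real U))) sequentially"
  by (intro eventually_conj; real_asymp)

theorem theorem6p1:
  "(\<lambda>U::nat. gamma_2_1 (lower_triangular_ones U))
     \<in> \<Omega>(\<lambda>U. ln (real U) powr (3/2) / ln (ln (real U)))"
proof (rule landau_omega.bigI[of "1 / (2 * 10 ^ 6)"])
  define l where "l U = nat \<lfloor>log 2 (real U)\<rfloor> - 1" for U :: nat
  have "filterlim l at_top sequentially"
    unfolding l_def by (rule filterlim_dyadic_depth)
  note ev = eventually_compose_filterlim[OF eventually_parameters this]
  show "eventually (\<lambda>U. 1 / (2 * 10 ^ 6) * norm (ln (real U) powr (3/2) / ln (ln (real U)))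
      \<le> norm (gamma_2_1 (lower_triangular_ones U))) sequentially"
    using ev eventually_ln_bounds
  proof eventually_elim
    case (elim U)
    define L where "L = l U"
    define G where "G = real L ^ 3 / (10 ^ 12 * ln (real L) ^ 2)"
    define t where "t = ln (real U)"
    have U: "4 \<le> U" and lnln: "1 \<le> ln t" and t: "25 * 2 \<le> 11 * t" and ln2: "ln (2 * t) \<le> 2 * ln t"
      using elim(2) by (simp_all add: t_def)
    have t0: "0 < t" using U by (simp add: t_def)
    have t1: "1 < t" using lnln ln_gt_zero_iff[OF t0] by linarith
    \<comment> \<open>The aim is \<open>t + 2 \<le> log 2 U\<close>, which leaves room for both the
      floor and the subtracted one in \<open>l\<close>, so that \<open>t \<le> L\<close>.\<close>
    have "ln (2 :: real) \<le> 25 / 36" by (rule ln2_le_25_over_36)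
    then have "(t + 2) * ln 2 \<le> (t + 2) * (25 / 36)" using t0 by (intro mult_left_mono) auto
    also have "\<dots> \<le> t" using t by simp
    finally have "t + 2 \<le> log 2 (real U)" by (simp add: log_def t_def[symmetric] pos_le_divide_eq)
    then have L: "t \<le> L" "L + 1 \<le> log 2 (real U)"
      using t0 unfolding L_def l_def by linarith+
    have "log 2 (real U) \<le> 2 * t"
    proof -
      have "1 / 2 \<le> ln (2 :: real)" using ln2_ge_two_thirds by simp
      then have "2 * t * (1 / 2) \<le> 2 * t * ln 2" using t0 by (intro mult_left_mono) auto
      then show ?thesis by (simp add: log_def t_def[symmetric] pos_divide_le_eq)
    qed
    then have "ln (real L) \<le> ln (2 * t)" using L t0 by simp
    then have lnL: "ln (real L) \<le> 2 * ln t" using ln2 by linarith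
    have lnL0: "0 < ln (real L)" using L t1 by simp
    have "real (2 ^ (L + 1)) = 2 powr (real (L + 1))" by (simp add: powr_realpow[symmetric] powr_add)
    also have "\<dots> \<le> 2 powr (log 2 (real U))" using L by (intro powr_mono) auto
    also have "\<dots> = real U" using U by simp
    finally have U2: "2 ^ (L + 1) \<le> U" by (simp only: of_nat_le_iff)
    note params = elim(1)[unfolded L_def[symmetric], unfolded G_def[symmetric]]
    have "0 < L ^ 3" using params by simp
    with params have "sqrt G \<le> gamma_2_1 (lower_triangular_ones U)"
      by (intro gamma_2_1_lower_triangular_ones_ge[OF U2, where N = "L ^ 3"
            and q = "nat \<lfloor>real L / (200 * ln (real L))\<rfloor>"]) blast+
    moreover have "sqrt G = real L powr (3 / 2) / (10 ^ 6 * ln (real L))"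
    proof -
      have "(real L powr (3 / 2))\<^sup>2 = real L powr (real 3)"
        by (simp add: power2_eq_square flip: powr_add)
      also have "\<dots> = real L ^ 3" using L t0 by (intro powr_realpow) linarith
      finally have "G = (real L powr (3 / 2) / (10 ^ 6 * ln (real L)))\<^sup>2"
        by (simp add: G_def power_divide power_mult_distrib)
      then show ?thesis using lnL0 by simp
    qed
    \<comment> \<open>The bound \<open>ln L \<le> 2 * ln t\<close> accounts for the factor 2 in the
      final constant, and \<open>10 ^ 6\<close> is the root of the constant in
      \<open>G\<close>.\<close>
    moreover have "t powr (3 / 2) / (10 ^ 6 * (2 * ln t)) \<le> real L powr (3 / 2) / (10 ^ 6 * ln (real L))"
      using L t0 lnL lnL0 by (intro frac_le powr_mono2 mult_left_mono) auto
    ultimately have "t powr (3 / 2) / (10 ^ 6 * (2 * ln t)) \<le> gamma_2_1 (lower_triangular_ones U)" by linarith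
    then show ?case using lnln unfolding t_def[symmetric] by simp
  qed
qed simp

end
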